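(* Let $x_1,\dots,x_n\in\mathbb{R}$. The volume of the permutohedron $P_n=P_n(x_1,\dots,x_n)$ is equal to $$\mathrm{Vol}\,P_n=\sum(-1)^{|I_{c_1,\dots,c_n}|}\,D_n(I_{c_1,\dots,c_n})\,\frac{x_1^{c_1}}{c_1!}\cdots\frac{x_n^{c_n}}{c_n!},$$ where the sum is over sequences of nonnegative integers $c_1,\dots,c_n$ such that $c_1+\cdots+c_n=n-1$.
   Context: $S_n$ is the symmetric group on $\{1,\dots,n\}$. For $x_1,\dots,x_n\in\mathbb{R}$, the permutohedron $P_n(x_1,\dots,x_n)\subset\mathbb{R}^n$ is the convex hull of the points $(x_{w(1)},\dots,x_{w(n)})$, $w\in S_n$. It lies in the hyperplane $t_1+\cdots+t_n=x_1+\cdots+x_n$. For a polytope $P$ contained in a hyperplane $t_1+\cdots+t_n=c$ of $\mathbb{R}^n$, $\mathrm{Vol}\,P$ denotes the usual $(n-1)$-dimensional volume of the image of $P$ under the projection $(t_1,\dots,t_n)\mapsto(t_1,\dots,t_{n-1})$. The set $I_{c_1,\dots,c_n}$: given nonnegative integers $c_1,\dots,c_n$ with $c_1+\cdots+c_n=n-1$, form a sequence $(\epsilon_1,\dots,\epsilon_{2n-2})\in\{1,-1\}^{2n-2}$ by replacing each entry $c_i$ ($i=1,\dots,n$, in order) by $c_i$ copies of $1$ followed by a single $-1$, and then removing the last $-1$. Define $$I_{c_1,\dots,c_n}=\{i\in\{1,\dots,n-1\}\mid \epsilon_1+\cdots+\epsilon_{2i-1}<0\}.$$ The descent set of $w\in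 S_n$ is $I(w)=\{i\in\{1,\dots,n-1\}\mid w(i)>w(i+1)\}$. For $I\subseteq\{1,\dots,n-1\}$, $D_n(I)$ is the number of permutations $w\in S_n$ with descent set $I(w)=I$.
   Formalization: The formula is proved for n ≥ 1 and x_1 ≥ ... ≥ x_n; without this ordering it is false (for n = 2 the right side is x_1 − x_2, the volume is |x_1 − x_2|), and every permutohedron has such an ordering of its parameters. *)

theory Defs
  imports
    "HOL-Analysis.Analysis"
    "HOL-Combinatorics.Permutations"
    "HOL-Library.Function_Algebras"
begin

text \<open>The pointwise vector space structure on functions; it makes the library's
  \<^term>\<open>convex hull S\<close> available for sets of coordinate functions \<^typ>\<open>nat \<Rightarrow> real\<close>.\<close>

instantiation "fun" :: (type, real_vector) real_vector
begin

definition scaleR_fun :: "real \<Rightarrow> ('a \<Rightarrow> 'b) \<Rightarrow> 'a \<Rightarrow> 'b" where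
  "scaleR_fun r f = (\<lambda>i. r *\<^sub>R f i)"

instance
  by standard (auto simp: scaleR_fun_def plus_fun_def fun_eq_iff scaleR_add_right scaleR_add_left)

end

text \<open>A point \<open>(t\<^sub>1, \<dots>, t\<^sub>n)\<close> of \<open>\<real>\<^sup>n\<close> is a function \<^typ>\<open>nat \<Rightarrow> real\<close> on \<^term>\<open>{1..n}\<close> that is
  \<^term>\<open>undefined\<close> elsewhere, as in the product measures \<^const>\<open>PiM\<close>.  Such functions form an affine
  subspace, so convex hulls stay inside it.\<close>

definition permutohedron :: "nat \<Rightarrow> (nat \<Rightarrow> real) \<Rightarrow> (nat \<Rightarrow> real) set" where
  "permutohedron n x = convex hull {(\<lambda>i\<in>{1..n}. x (w i)) | w. w permutes {1..n}}"

text \<open>The \<open>(n-1)\<close>-dimensional volume of a polytope in a hyperplane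
  \<open>t\<^sub>1 + \<dots> + t\<^sub>n = c\<close> of \<open>\<real>\<^sup>n\<close>: Lebesgue measure of its projection that forgets \<open>t\<^sub>n\<close>.
  For \<open>n = 1\<close> the projection lands in the one-point space \<open>\<real>\<^sup>0\<close>, whose point has measure 1.\<close>

definition Vol :: "nat \<Rightarrow> (nat \<Rightarrow> real) set \<Rightarrow> real" where
  "Vol n P = measure (\<Pi>\<^sub>M i\<in>{1..n-1}. lborel) ((\<lambda>t. restrict t {1..n-1}) ` P)"

definition eps_seq :: "nat \<Rightarrow> (nat \<Rightarrow> nat) \<Rightarrow> int list" where
  "eps_seq n c = butlast (concat (map (\<lambda>i. replicate (c i) 1 @ [-1]) [1..<Suc n]))"

definition I_set :: "nat \<Rightarrow> (nat \<Rightarrow> nat) \<Rightarrow> nat set" where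
  "I_set n c = {i \<in> {1..n-1}. sum_list (take (2 * i - 1) (eps_seq n c)) < 0}"

definition descent_set :: "nat \<Rightarrow> (nat \<Rightarrow> nat) \<Rightarrow> nat set" where
  "descent_set n w = {i \<in> {1..n-1}. w i > w (i + 1)}"

definition D :: "nat \<Rightarrow> nat set \<Rightarrow> nat" where
  "D n I = card {w. w permutes {1..n} \<and> descent_set n w = I}"

text \<open>The sequences \<open>(c\<^sub>1, \<dots>, c\<^sub>n)\<close> of nonnegative integers with sum \<open>n - 1\<close>; extensionality
  on \<^term>\<open>{1..n}\<close> makes each sequence occur exactly once.\<close>

definition exponents :: "nat \<Rightarrow> (nat \<Rightarrow> nat) set" where
  "exponents n = {c \<in> {1..n} \<rightarrow>\<^sub>E UNIV. (\<Sum>i=1..n. c i) = n - 1}"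

text \<open>The permutohedron depends only on the multiset of its parameters, whereas the polynomial
  \<open>\<Sum> (-1)^|I\<^sub>c| D\<^sub>n(I\<^sub>c) x\<^sup>c / c!\<close> is not symmetric: for \<open>n = 2\<close> it is \<open>x\<^sub>1 - x\<^sub>2\<close>, while the
  volume is \<open>|x\<^sub>1 - x\<^sub>2|\<close>.  The parameters are therefore listed in weakly decreasing
  order \<open>x\<^sub>1 \<ge> \<dots> \<ge> x\<^sub>n\<close> in the volume formula; every permutohedron has such a listing.\<close>

end

theory Submission
  imports Defs
begin

text \<open>Let \<open>x\<^sub>1 \<ge> \<dots> \<ge> x\<^sub>n\<^sub>+\<^sub>1\<close>.  The slice of \<open>P\<^sub>n\<^sub>+\<^sub>1(x)\<close> at \<open>t\<^sub>n\<^sub>+\<^sub>1 = s\<close>, where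
  \<open>x\<^sub>k\<^sub>+\<^sub>1 \<le> s \<le> x\<^sub>k\<close>, is the smaller permutohedron obtained by replacing \<open>x\<^sub>k, x\<^sub>k\<^sub>+\<^sub>1\<close> by the single
  parameter \<open>x\<^sub>k + x\<^sub>k\<^sub>+\<^sub>1 - s\<close>.  Integrating over \<open>s\<close> expresses \<open>Vol P\<^sub>n\<^sub>+\<^sub>1\<close> by integrals of
  \<open>Vol P\<^sub>n\<close>, and on coefficients \<open>a\<^sub>n(c)\<close> of \<open>x\<^sup>c / c!\<close> this is the recursion
  \<open>a\<^sub>n\<^sub>+\<^sub>1(c) = (\<Sum>k. ([c\<^sub>k\<^sub>+\<^sub>1 = 0] - [c\<^sub>k = 0]) a\<^sub>n(c\<^sub>1, \<dots>, c\<^sub>k + c\<^sub>k\<^sub>+\<^sub>1 - 1, \<dots>, c\<^sub>n\<^sub>+\<^sub>1))\<close>.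
  Since \<open>I\<^sub>c = {i. c\<^sub>1 + \<dots> + c\<^sub>i < i}\<close>, merging \<open>c\<^sub>k\<close> and \<open>c\<^sub>k\<^sub>+\<^sub>1\<close> deletes the letter \<open>k\<close> from the
  descent pattern \<open>I\<^sub>c\<close>.  Summation by parts leaves only those \<open>k\<close> at which the pattern changes from
  ascent to descent, and these terms are the recursion for \<open>(-1)^|I| D(I)\<close> that comes from removing
  the largest value, which sits at a peak of the permutation.\<close>

subsection \<open>Descent patterns\<close>

lemma sum_list_pm1:
  assumes "set xs \<subseteq> {1, -1 :: int}"
  shows "sum_list xs = int (length xs) - 2 * int (count_list xs (-1))"
  using assms by (induction xs) auto

lemma count_list_take_le: "count_list (take m xs) a \<le> count_list xs a"
  by (metis append_take_drop_id count_list_append le_add1)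

text \<open>A sum of \<open>2 i - 1\<close> signs is negative iff at least \<open>i\<close> of them are \<open>-1\<close>, and the \<open>i\<close>-th
  \<open>-1\<close> of the sequence stands at position \<open>c\<^sub>1 + \<dots> + c\<^sub>i + i\<close>.\<close>

lemma I_set_eq:
  assumes "(\<Sum>i=1..n. c i) = n - 1"
  shows "I_set n c = {i \<in> {1..n-1}. (\<Sum>j=1..i. c j) < i}"
proof -
  \<comment> \<open>\<open>B m\<close> keeps its final -1, so it ends exactly at the m-th -1 and is
    a prefix of every later \<open>B m'\<close>; \<open>eps_seq n c\<close> is
    \<open>butlast (B n)\<close>.\<close>
  define B where "B m = concat (map (\<lambda>i. replicate (c i) 1 @ [-1 :: int]) [1..<Suc m])" for m
  have B_Suc: "B (Suc m) = B m @ replicate (c (Suc m)) 1 @ [-1]" for m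
    by (simp add: B_def)
  have B0: "B 0 = []"
    by (simp add: B_def)
  have len: "length (B m) = (\<Sum>j=1..m. c j) + m" for m
    by (induction m) (auto simp: B_Suc B0)
  have set: "set (B m) \<subseteq> {1, -1}" for m
    by (induction m) (auto simp: B_Suc B0)
  have cnt_rep: "count_list (replicate k 1) (-1 :: int) = 0" for k
    by (induction k) auto
  have cnt: "count_list (B m) (-1) = m" for m
    by (induction m) (auto simp: B_Suc B0 cnt_rep)
  have mono: "\<exists>r. B m' = B m @ r" if "m \<le> m'" for m m'
    using that
  proof (induction m' rule: dec_induct)
    case (step k)
    then show ?case by (auto simp: B_Suc)
  qed auto
  have key: "sum_list (take (2 * i - 1) (eps_seq n c)) < 0 \<longleftrightarrow> (\<Sum>j=1..i. c j) < i"
    if i: "i \<in> {1..n-1}" for i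
  proof -
    have ln: "length (B n) = 2 * n - 1"
      using len[of n] assms i by simp
    \<comment> \<open>The dropped last sign lies outside: 2i - 1 is less than 2n - 1, the length of
      \<open>B n\<close>.\<close>
    have tk: "take (2 * i - 1) (eps_seq n c) = take (2 * i - 1) (B n)"
      unfolding eps_seq_def B_def[symmetric] by (rule take_butlast) (use ln i in auto)
    have "set (take (2 * i - 1) (B n)) \<subseteq> {1, -1}"
      using set[of n] set_take_subset by fast
    then have sm: "sum_list (take (2 * i - 1) (B n))
        = int (2 * i - 1) - 2 * int (count_list (take (2 * i - 1) (B n)) (-1))"
      using sum_list_pm1 ln i by force
    obtain r where r: "B n = B i @ r"
      using mono[of i n] i by (metis atLeastAtMost_iff diff_le_self le_trans)
    show ?thesis
    proof (cases "(\<Sum>j=1..i. c j) < i")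
      case True
      then have "take (2 * i - 1) (B n) = B i @ take (2 * i - 1 - length (B i)) r"
        using r len[of i] by auto
      then have "count_list (take (2 * i - 1) (B n)) (-1) \<ge> i"
        by (simp add: cnt)
      then show ?thesis
        using True sm tk i by auto
    next
      case False
      obtain i' where i': "i = Suc i'"
        using i by (cases i) auto
      have "take (2 * i - 1) (B n) = take (2 * i - 1) (B i)"
        using r len[of i] False by auto
      \<comment> \<open>\<open>B i\<close> now has length at least 2i, so the prefix misses its
        final -1 and sees at most i - 1 of them.\<close>
      also have "\<dots> = take (2 * i - 1) (B i' @ replicate (c i) 1)"
        using len[of i] False i' by (simp add: B_Suc)
      finally have "count_list (take (2 * i - 1) (B n)) (-1) \<le> i'"
        using count_list_take_le[of "2 * i - 1" "B i' @ replicate (c i) 1" "-1"] cnt[of i'] cnt_rep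
        by simp
      then show ?thesis
        using False sm tk i i' by auto
    qed
  qed
  then show ?thesis
    unfolding I_set_def by blast
qed

section \<open>Deleting a letter from a descent pattern\<close>

definition skip :: "nat \<Rightarrow> nat \<Rightarrow> nat" where
  "skip k i = (if i < k then i else Suc i)"

text \<open>A subset of \<open>{1..n}\<close> is read as a word of n ascents and descents. Deleting
  its k-th letter and renumbering by \<open>skip k\<close> gives a word of n - 1 letters, a pattern
  for permutations of n elements.\<close>

definition shrink :: "nat \<Rightarrow> nat \<Rightarrow> nat set \<Rightarrow> nat set" where
  "shrink n k I = {i \<in> {1..n-1}. skip k i \<in> I}"

definition signed_D :: "nat \<Rightarrow> nat set \<Rightarrow> real" where
  "signed_D n I = (-1) ^ card I * real (D n I)"

lemma inj_skip: "inj_on (skip k) A"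
  by (auto simp: inj_on_def skip_def split: if_splits)

lemma skip_image:
  assumes "k \<in> {1..n}"
  shows "skip k ` {1..n-1} = {1..n} - {k}"
proof
  show "skip k ` {1..n-1} \<subseteq> {1..n} - {k}"
    using assms by (auto simp: skip_def)
  show "{1..n} - {k} \<subseteq> skip k ` {1..n-1}"
  proof
    fix j assume j: "j \<in> {1..n} - {k}"
    show "j \<in> skip k ` {1..n-1}"
    proof (cases "j < k")
      case True
      then show ?thesis using j assms by (intro image_eqI[of _ _ j]) (auto simp: skip_def)
    next
      case False
      then show ?thesis using j assms by (intro image_eqI[of _ _ "j - 1"]) (auto simp: skip_def)
    qed
  qed
qed

text \<open>\<open>skip k\<close> maps the shrunken pattern bijectively onto \<open>I - {k}\<close>.
  This controls the signs: deleting a descent flips the parity, deleting an ascent keeps it.\<close>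

lemma card_shrink:
  assumes "I \<subseteq> {1..n}" "k \<in> {1..n}"
  shows "card (shrink n k I) = card (I - {k})"
proof -
  have "skip k ` shrink n k I = I - {k}"
  proof -
    have "skip k ` shrink n k I = skip k ` {1..n-1} \<inter> I"
      by (auto simp: shrink_def)
    also have "\<dots> = I - {k}"
      using skip_image[OF assms(2)] assms(1) by auto
    finally show ?thesis .
  qed
  then show ?thesis
    by (metis card_image inj_skip)
qed

text \<open>Deleting either of two equal adjacent letters leaves the same word; such pairs cancel in
  the summation by parts.\<close>

lemma shrink_Suc_eq:
  assumes "k \<in> I \<longleftrightarrow> Suc k \<in> I"
  shows "shrink n k I = shrink n (Suc k) I"
  using assms by (auto simp: shrink_def skip_def less_Suc_eq split: if_splits)

section \<open>Removing the largest value of a permutation\<close>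

text \<open>Precomposition with this cycle moves the \<open>p\<close>-th letter of a word to the end.\<close>

definition cyc :: "nat \<Rightarrow> nat \<Rightarrow> nat \<Rightarrow> nat" where
  "cyc n p i = (if i = Suc n then p else if i \<in> {1..n} then skip p i else i)"

lemma cyc_permutes:
  assumes "p \<in> {1..Suc n}"
  shows "cyc n p permutes {1..Suc n}"
proof (rule bij_imp_permutes)
  have inj: "inj_on (cyc n p) {1..Suc n}"
    using assms by (auto simp: inj_on_def cyc_def skip_def split: if_splits)
  moreover have "cyc n p ` {1..Suc n} \<subseteq> {1..Suc n}"
    using assms by (auto simp: cyc_def skip_def split: if_splits)
  ultimately show "bij_betw (cyc n p) {1..Suc n} {1..Suc n}"
    by (simp add: bij_betw_def endo_inj_surj)
qed (auto simp: cyc_def)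

lemma permutes_fix_last:
  "w permutes {1..n} \<longleftrightarrow> w permutes {1..Suc n} \<and> w (Suc n) = Suc n"
proof (intro iffI conjI)
  assume w: "w permutes {1..n}"
  show "w permutes {1..Suc n}"
    by (rule permutes_subset[OF w]) auto
  show "w (Suc n) = Suc n"
    by (rule permutes_not_in[OF w]) simp
next
  assume w: "w permutes {1..Suc n} \<and> w (Suc n) = Suc n"
  show "w permutes {1..n}"
  proof (rule permutes_superset[of w "{1..Suc n}"])
    show "w permutes {1..Suc n}"
      using w ..
    fix i assume "i \<in> {1..Suc n} - {1..n}"
    then have "i = Suc n"
      by auto
    then show "w i = i"
      using w by blast
  qed
qed

text \<open>The local condition at a position \<open>p\<close> that carries the largest value: an
  ascent before it and a descent after it, where the positions 1 and n + 1 have only one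
  neighbour.\<close>

definition peak :: "nat \<Rightarrow> nat set \<Rightarrow> nat \<Rightarrow> bool" where
  "peak n I p \<longleftrightarrow> (p = 1 \<or> p - 1 \<notin> I) \<and> (p = Suc n \<or> p \<in> I)"

text \<open>The maximum at \<open>p\<close> forces an ascent before and a descent after it, and
  comparisons that avoid \<open>p\<close> survive its removal. The comparison of the two former
  neighbours of \<open>p\<close>, at the index i with \<open>Suc i = p\<close>, is new, and
  \<open>I\<close> leaves it free.\<close>

lemma descent_set_cyc:
  assumes w: "w permutes {1..Suc n}" and p: "p \<in> {1..Suc n}" "w p = Suc n"
    and I: "I \<subseteq> {1..n}"
  shows "descent_set (Suc n) w = I \<longleftrightarrow> peak n I p \<and>
    (\<forall>i\<in>{1..n-1}. Suc i \<noteq> p \<longrightarrow> (i \<in> descent_set n (w \<circ> cyc n p) \<longleftrightarrow> skip p i \<in> I))"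
proof -
  have lt: "w i < Suc n" if "i \<in> {1..Suc n}" "i \<noteq> p" for i
    using permutes_in_image[OF w, of i] that p permutes_inj[OF w]
    by (metis atLeastAtMost_iff injD le_neq_implies_less)
  have max_desc: "p \<in> descent_set (Suc n) w" if "p \<noteq> Suc n"
    using lt[of "Suc p"] that p by (auto simp: descent_set_def)
  have max_asc: "p - 1 \<notin> descent_set (Suc n) w"
    using lt[of "p - 1"] p by (cases p) (auto simp: descent_set_def)
  have other: "i \<in> descent_set n (w \<circ> cyc n p) \<longleftrightarrow> skip p i \<in> descent_set (Suc n) w"
    if "i \<in> {1..n-1}" "Suc i \<noteq> p" for i
    using that by (auto simp: descent_set_def cyc_def skip_def)
  have sub: "descent_set (Suc n) w \<subseteq> {1..n}"
    by (auto simp: descent_set_def)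
  show ?thesis
  proof
    assume "descent_set (Suc n) w = I"
    then show "peak n I p \<and>
      (\<forall>i\<in>{1..n-1}. Suc i \<noteq> p \<longrightarrow> (i \<in> descent_set n (w \<circ> cyc n p) \<longleftrightarrow> skip p i \<in> I))"
      using max_desc max_asc other by (auto simp: peak_def)
  next
    assume R: "peak n I p \<and>
      (\<forall>i\<in>{1..n-1}. Suc i \<noteq> p \<longrightarrow> (i \<in> descent_set n (w \<circ> cyc n p) \<longleftrightarrow> skip p i \<in> I))"
    have "j \<in> descent_set (Suc n) w \<longleftrightarrow> j \<in> I" if j: "j \<in> {1..n}" for j
    proof -
      consider "j = p" | "Suc j = p" | "j \<noteq> p" "Suc j \<noteq> p" by blast
      then show ?thesis
      proof cases
        case 1
        then show ?thesis using R max_desc j by (auto simp: peak_def)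
      next
        case 2
        then show ?thesis using R max_asc j by (auto simp: peak_def)
      next
        case 3
        define i where "i = (if j < p then j else j - 1)"
        have "skip p i = j" "i \<in> {1..n-1}" "Suc i \<noteq> p"
          using 3 j p(1) by (auto simp: i_def skip_def split: if_splits)
        then show ?thesis using R other by metis
      qed
    qed
    then show "descent_set (Suc n) w = I"
      using sub I by blast
  qed
qed

text \<open>Composing with \<open>cyc n p\<close> moves the maximum to the last position, and a
  permutation of \<open>{1..Suc n}\<close> that fixes \<open>Suc n\<close> is the same function as a
  permutation of \<open>{1..n}\<close>.\<close>

lemma card_permutes_max_at:
  assumes p: "p \<in> {1..Suc n}"
  shows "card {w. w permutes {1..Suc n} \<and> w p = Suc n \<and> Q (w \<circ> cyc n p)}
    = card {v. v permutes {1..n} \<and> Q v}"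
proof (rule bij_betw_same_card)
  note c = cyc_permutes[OF p]
  have cp: "cyc n p (Suc n) = p"
    by (simp add: cyc_def)
  have inv: "inv (cyc n p) p = Suc n"
    using permutes_inverses(2)[OF c, of "Suc n"] cp by simp
  have last_fixed: "v permutes {1..n} \<longleftrightarrow> v permutes {1..Suc n} \<and> v (Suc n) = Suc n" for v
    by (rule permutes_fix_last)
  have comp: "w \<circ> cyc n p permutes {1..n}" if "w permutes {1..Suc n}" "w p = Suc n" for w
    unfolding last_fixed using permutes_compose[OF c that(1)] that(2) cp by simp
  have comp_inv: "v \<circ> inv (cyc n p) permutes {1..Suc n}" "(v \<circ> inv (cyc n p)) p = Suc n"
    if "v permutes {1..n}" for v
    using permutes_compose[OF permutes_inv[OF c], of v] that inv unfolding last_fixed by simp_all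
  have id: "w \<circ> cyc n p \<circ> inv (cyc n p) = w" "w \<circ> inv (cyc n p) \<circ> cyc n p = w" for w :: "nat \<Rightarrow> nat"
    by (simp_all add: comp_assoc permutes_inv_o[OF c])
  show "bij_betw (\<lambda>w. w \<circ> cyc n p) {w. w permutes {1..Suc n} \<and> w p = Suc n \<and> Q (w \<circ> cyc n p)}
      {v. v permutes {1..n} \<and> Q v}"
  proof (rule bij_betw_byWitness[where f' = "\<lambda>v. v \<circ> inv (cyc n p)"])
    show "(\<lambda>w. w \<circ> cyc n p) ` {w. w permutes {1..Suc n} \<and> w p = Suc n \<and> Q (w \<circ> cyc n p)}
        \<subseteq> {v. v permutes {1..n} \<and> Q v}"
      using comp by blast
    show "(\<lambda>v. v \<circ> inv (cyc n p)) ` {v. v permutes {1..n} \<and> Q v}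
        \<subseteq> {w. w permutes {1..Suc n} \<and> w p = Suc n \<and> Q (w \<circ> cyc n p)}"
    proof clarify
      fix v assume v: "v permutes {1..n}" "Q v"
      show "v \<circ> inv (cyc n p) permutes {1..Suc n} \<and> (v \<circ> inv (cyc n p)) p = Suc n \<and>
          Q (v \<circ> inv (cyc n p) \<circ> cyc n p)"
        unfolding id using comp_inv[OF v(1)] v(2) by blast
    qed
  qed (unfold id, (rule ballI, rule refl)+)
qed

section \<open>Recursion for the descent numbers\<close>

lemma eq_shrink_iff:
  assumes "X \<subseteq> {1..n-1}"
  shows "X = shrink n k I \<longleftrightarrow> (\<forall>i\<in>{1..n-1}. i \<in> X \<longleftrightarrow> skip k i \<in> I)"
  using assms unfolding shrink_def by blast

lemma skip_eq_skip_Suc: "i \<noteq> q \<Longrightarrow> skip (Suc q) i = skip q i"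
  by (simp add: skip_def)

text \<open>Only membership of \<open>q\<close> in \<open>X\<close> is free. Deleting the ascent
  \<open>q\<close> leaves a descent there, deleting the descent \<open>Suc q\<close> leaves an
  ascent, and elsewhere both words agree, so they are the two possible completions.\<close>

lemma eq_shrink_off_iff:
  assumes X: "X \<subseteq> {1..n-1}" and q: "q \<in> {1..n-1}" "q \<notin> I" "Suc q \<in> I"
  shows "(\<forall>i\<in>{1..n-1}. i \<noteq> q \<longrightarrow> (i \<in> X \<longleftrightarrow> skip (Suc q) i \<in> I)) \<longleftrightarrow>
    X = shrink n q I \<or> X = shrink n (Suc q) I"
proof -
  have "skip q q \<in> I" "skip (Suc q) q \<notin> I"
    using q by (simp_all add: skip_def)
  have split: "(\<forall>i\<in>{1..n-1}. P i) \<longleftrightarrow> P q \<and> (\<forall>i\<in>{1..n-1} - {q}. P i)" for P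
    using q(1) by blast
  define P where "P \<longleftrightarrow> (\<forall>i\<in>{1..n-1} - {q}. i \<in> X \<longleftrightarrow> skip (Suc q) i \<in> I)"
  have "P \<longleftrightarrow> (\<forall>i\<in>{1..n-1} - {q}. i \<in> X \<longleftrightarrow> skip q i \<in> I)"
    unfolding P_def by (rule ball_cong) (simp_all add: skip_eq_skip_Suc)
  then have "X = shrink n q I \<longleftrightarrow> q \<in> X \<and> P"
    unfolding eq_shrink_iff[OF X] split using \<open>skip q q \<in> I\<close> by simp
  moreover have "X = shrink n (Suc q) I \<longleftrightarrow> q \<notin> X \<and> P"
    unfolding eq_shrink_iff[OF X] split using \<open>skip (Suc q) q \<notin> I\<close> by (simp add: P_def)
  moreover have "(\<forall>i\<in>{1..n-1}. i \<noteq> q \<longrightarrow> (i \<in> X \<longleftrightarrow> skip (Suc q) i \<in> I)) \<longleftrightarrow> P"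
    unfolding split by (simp add: P_def)
  ultimately show ?thesis
    by blast
qed

text \<open>Permutations are sorted by the position \<open>p\<close> of the largest value. At an
  inner \<open>p\<close> the free comparison of its neighbours yields two patterns, at either end
  there is just one.\<close>

lemma D_rec:
  assumes n: "n \<ge> 1" and I: "I \<subseteq> {1..n}"
  shows "D (Suc n) I = (\<Sum>p=1..Suc n. if peak n I p then
      (if p = 1 then 0 else D n (shrink n (p - 1) I)) +
      (if p = Suc n then 0 else D n (shrink n p I)) else 0)"
proof -
  let ?W = "\<lambda>p. {w. w permutes {1..Suc n} \<and> w p = Suc n \<and> descent_set (Suc n) w = I}"
  have fin: "finite {w. w permutes {1..m}}" for m :: nat
    by (rule finite_permutations) simp
  have "{w. w permutes {1..Suc n} \<and> descent_set (Suc n) w = I} = (\<Union>p\<in>{1..Suc n}. ?W p)"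
  proof -
    have "\<exists>p\<in>{1..Suc n}. w p = Suc n" if "w permutes {1..Suc n}" for w
      using permutes_image[OF that] by (metis atLeastAtMost_iff imageE le_refl n trans_le_add1 Suc_eq_plus1)
    then show ?thesis by auto
  qed
  also have "card \<dots> = (\<Sum>p=1..Suc n. card (?W p))"
  proof (rule card_UN_disjoint)
    show "\<forall>p\<in>{1..Suc n}. finite (?W p)"
      by (auto intro: finite_subset[OF _ fin[of "Suc n"]])
    have "p = q" if "w permutes {1..Suc n}" "w p = Suc n" "w q = Suc n" for w p q
      using permutes_inj[OF that(1)] that(2,3) by (metis injD)
    then show "\<forall>p\<in>{1..Suc n}. \<forall>q\<in>{1..Suc n}. p \<noteq> q \<longrightarrow> ?W p \<inter> ?W q = {}"
      by blast
  qed simp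
  also have "\<dots> = (\<Sum>p=1..Suc n. if peak n I p then
      (if p = 1 then 0 else D n (shrink n (p - 1) I)) +
      (if p = Suc n then 0 else D n (shrink n p I)) else 0)"
  proof (rule sum.cong[OF refl])
    fix p assume p: "p \<in> {1..Suc n}"
    define Q where "Q v \<longleftrightarrow> (\<forall>i\<in>{1..n-1}. Suc i \<noteq> p \<longrightarrow> (i \<in> descent_set n v \<longleftrightarrow> skip p i \<in> I))"
      for v
    have ds: "descent_set n v \<subseteq> {1..n-1}" for v
      by (auto simp: descent_set_def)
    have "?W p = {w. w permutes {1..Suc n} \<and> w p = Suc n \<and> (peak n I p \<and> Q (w \<circ> cyc n p))}"
      using descent_set_cyc[OF _ p _ I] unfolding Q_def by blast
    then have W: "card (?W p) = card {v. v permutes {1..n} \<and> peak n I p \<and> Q v}"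
      using card_permutes_max_at[OF p, of "\<lambda>v. peak n I p \<and> Q v"] by simp
    show "card (?W p) = (if peak n I p then
      (if p = 1 then 0 else D n (shrink n (p - 1) I)) +
      (if p = Suc n then 0 else D n (shrink n p I)) else 0)"
    proof (cases "peak n I p")
      case True
      consider "p = 1" | "p = Suc n" | "1 < p" "p \<le> n" using p by force
      then show ?thesis
      proof cases
        case 1
        have "Q v \<longleftrightarrow> descent_set n v = shrink n p I" for v
          unfolding Q_def eq_shrink_iff[OF ds] using 1 by simp
        then show ?thesis using W True 1 n by (simp add: D_def)
      next
        case 2
        \<comment> \<open>There is no letter n + 1 to delete; on \<open>{1..n-1}\<close> the maps
          \<open>skip (Suc n)\<close> and \<open>skip n\<close> coincide, so the last letter n is
          deleted.\<close>
        have "Q v \<longleftrightarrow> descent_set n v = shrink n n I" for v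
          unfolding Q_def eq_shrink_iff[OF ds] using 2 skip_eq_skip_Suc[of _ n] by force
        then show ?thesis using W True 2 n by (simp add: D_def)
      next
        case 3
        have pI: "p - 1 \<notin> I" "p \<in> I"
          using True 3 by (auto simp: peak_def)
        have "Q v \<longleftrightarrow> descent_set n v = shrink n (p - 1) I \<or> descent_set n v = shrink n p I" for v
          using eq_shrink_off_iff[OF ds, of "p - 1" I v] 3 pI
          unfolding Q_def by (cases p) auto
        then have "{v. v permutes {1..n} \<and> peak n I p \<and> Q v} =
            {v. v permutes {1..n} \<and> descent_set n v = shrink n (p - 1) I} \<union>
            {v. v permutes {1..n} \<and> descent_set n v = shrink n p I}"
          using True by blast
        moreover have "shrink n (p - 1) I \<noteq> shrink n p I"
        proof -
          have "p - 1 \<in> shrink n (p - 1) I" "p - 1 \<notin> shrink n p I"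
            using 3 pI by (auto simp: shrink_def skip_def)
          then show ?thesis by metis
        qed
        then have "{v. v permutes {1..n} \<and> descent_set n v = shrink n (p - 1) I} \<inter>
            {v. v permutes {1..n} \<and> descent_set n v = shrink n p I} = {}"
          by auto
        moreover have "finite {v. v permutes {1..n} \<and> descent_set n v = J}" for J
          by (rule finite_subset[OF _ fin[of n]]) auto
        ultimately show ?thesis
          using W True 3 by (simp add: card_Un_disjoint D_def)
      qed
    qed (use W in simp)
  qed
  finally show ?thesis
    unfolding D_def[of "Suc n" I] .
qed

lemma signed_D_rec:
  assumes n: "n \<ge> 1" and c: "(\<Sum>i=1..Suc n. c i) = n"
  defines "I \<equiv> I_set (Suc n) c"
  shows "signed_D (Suc n) I =
    (\<Sum>k=1..n. (of_bool (c (Suc k) = 0) - of_bool (c k = 0)) * signed_D n (shrink n k I))"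
proof -
  define C where "C i = (\<Sum>j=1..i. c j)" for i
  define f where "f k = signed_D n (shrink n k I)" for k
  define z :: "nat \<Rightarrow> real" where "z k = of_bool (c k = 0)" for k
  \<comment> \<open>\<open>b p\<close> is \<open>f (p - 1) - f p\<close> with boundary values 0 at
    both ends. Summation by parts turns the sum of \<open>z p * b p\<close> into the right-hand
    side.\<close>
  define b where "b p = (if p = 1 then 0 else f (p - 1)) - (if p = Suc n then 0 else f p)" for p
  have I_eq: "I = {i \<in> {1..n}. C i < i}"
    using I_set_eq[of c "Suc n"] c by (simp add: I_def C_def)
  have I: "I \<subseteq> {1..n}" "finite I"
    by (auto simp: I_eq)
  have C_Suc: "C (Suc i) = C i + c (Suc i)" for i
    by (simp add: C_def)
  have f_eq: "f k = (-1) ^ card (I - {k}) * real (D n (shrink n k I))" if "k \<in> {1..n}" for k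
    using card_shrink[OF I(1) that] by (simp add: f_def signed_D_def)
  have f_in: "(-1) ^ card I * real (D n (shrink n k I)) = - f k" if "k \<in> I" for k
  proof -
    have "(-1 :: real) ^ card I = - ((-1) ^ card (I - {k}))"
      unfolding card.remove[OF I(2) that] by simp
    moreover have "k \<in> {1..n}"
      using that I(1) by blast
    ultimately show ?thesis
      by (simp only: f_eq)
  qed
  have f_notin: "(-1) ^ card I * real (D n (shrink n k I)) = f k" if "k \<notin> I" "k \<in> {1..n}" for k
    using f_eq[of k] that by simp
  have "signed_D (Suc n) I = (\<Sum>p=1..Suc n. (-1) ^ card I * real (if peak n I p then
      (if p = 1 then 0 else D n (shrink n (p - 1) I)) +
      (if p = Suc n then 0 else D n (shrink n p I)) else 0))"
    unfolding signed_D_def D_rec[OF n I(1)] of_nat_sum sum_distrib_left ..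
  also have "\<dots> = (\<Sum>p=1..Suc n. z p * b p)"
  proof (rule sum.cong[OF refl])
    fix p assume p: "p \<in> {1..Suc n}"
    have L: "(-1) ^ card I * real (if peak n I p then
      (if p = 1 then 0 else D n (shrink n (p - 1) I)) +
      (if p = Suc n then 0 else D n (shrink n p I)) else 0) = of_bool (peak n I p) * b p"
    \<comment> \<open>At a peak, letter p - 1 is an ascent whose deletion keeps the sign, and letter
      p is a descent whose deletion reverses it.\<close>
    proof (cases "peak n I p")
      case True
      have "(-1) ^ card I * real (if p = 1 then 0 else D n (shrink n (p - 1) I))
          = (if p = 1 then 0 else f (p - 1))"
      proof (cases "p = 1")
        case False
        then have "p - 1 \<notin> I" "p - 1 \<in> {1..n}"
          using True p by (auto simp: peak_def)
        from f_notin[OF this] False show ?thesis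
          by simp
      qed simp
      moreover have "(-1) ^ card I * real (if p = Suc n then 0 else D n (shrink n p I))
          = - (if p = Suc n then 0 else f p)"
        using True f_in[of p] p by (auto simp: peak_def)
      ultimately show ?thesis
        using True unfolding b_def by (simp only: if_True of_nat_add distrib_left of_bool_eq) simp
    qed simp
    \<comment> \<open>The indicators of a peak and of \<open>c p = 0\<close> may differ, but only
      where \<open>b p = 0\<close>.\<close>
    have R: "of_bool (peak n I p) * b p = z p * b p"
    proof -
      obtain q where q: "p = Suc q"
        using p by (cases p) auto
      consider "q = 0" | "q = n" "n \<ge> 1" | "q \<ge> 1" "q < n" using p q n by force
      then show ?thesis
      proof cases
        case 1
        have "1 \<in> I \<longleftrightarrow> c 1 = 0"
          using n by (auto simp: I_eq C_def)
        then show ?thesis using 1 q n by (simp add: peak_def z_def)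
      next
        case 2
        \<comment> \<open>The total gives \<open>C n \<le> n\<close>, so letter n is an ascent
          exactly if \<open>C n = n\<close>.\<close>
        have "C n + c (Suc n) = n"
          using c by (simp add: C_def)
        then have "n \<notin> I \<longleftrightarrow> c (Suc n) = 0"
          using 2 by (auto simp: I_eq)
        then show ?thesis using 2 q by (simp add: peak_def z_def)
      next
        case 3
        show ?thesis
        proof (cases "q \<in> I \<longleftrightarrow> Suc q \<in> I")
          case True
          then have "b p = 0"
            using shrink_Suc_eq[OF True] 3 q by (simp add: b_def f_def)
          then show ?thesis by simp
        next
          case False
          \<comment> \<open>At a peak, \<open>C q \<ge> q\<close> and
            \<open>C (Suc q) \<le> q\<close> force \<open>c (Suc q) = 0\<close>. Conversely a zero
            entry keeps a descent a descent, so the only change it allows is from ascent to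
            descent.\<close>
          then have "peak n I p \<longleftrightarrow> c p = 0"
            using 3 q by (auto simp: peak_def I_eq C_Suc)
          then show ?thesis by (simp add: z_def)
        qed
      qed
    qed
    show "(-1) ^ card I * real (if peak n I p then
      (if p = 1 then 0 else D n (shrink n (p - 1) I)) +
      (if p = Suc n then 0 else D n (shrink n p I)) else 0) = z p * b p"
      using L R by simp
  qed
  also have "\<dots> = (\<Sum>p=1..Suc n. z p * (if p = 1 then 0 else f (p - 1)))
      - (\<Sum>p=1..Suc n. z p * (if p = Suc n then 0 else f p))"
    by (simp add: b_def right_diff_distrib sum_subtractf del: sum.cl_ivl_Suc)
  also have "(\<Sum>p=1..Suc n. z p * (if p = 1 then 0 else f (p - 1))) = (\<Sum>k=1..n. z (Suc k) * f k)"
  proof -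
    have "(\<Sum>p=1..Suc n. z p * (if p = 1 then 0 else f (p - 1)))
        = (\<Sum>p=Suc 1..Suc n. z p * (if p = 1 then 0 else f (p - 1)))"
      using n by (subst sum.atLeast_Suc_atMost) auto
    then show ?thesis
      by (simp add: sum.shift_bounds_cl_Suc_ivl del: sum.cl_ivl_Suc)
  qed
  also have "(\<Sum>p=1..Suc n. z p * (if p = Suc n then 0 else f p)) = (\<Sum>k=1..n. z k * f k)"
    by simp
  finally show ?thesis
    by (simp add: f_def z_def left_diff_distrib sum_subtractf)
qed

subsection \<open>Slices of permutohedra\<close>

text \<open>With \<open>j = card B\<close>, the elements of \<open>B\<close> beyond j are as many as
  the elements of \<open>{1..j}\<close> missing from \<open>B\<close>, and \<open>x j\<close>
  separates their values.\<close>

lemma antimono_sum_le: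
  fixes x :: "nat \<Rightarrow> real"
  assumes x: "antimono_on {1..n} x" and B: "B \<subseteq> {1..n}"
  shows "sum x B \<le> sum x {1..card B}"
proof -
  define j where "j = card B"
  have fin: "finite B"
    using B finite_subset by blast
  have jn: "j \<le> n"
    using card_mono[OF _ B] by (simp add: j_def)
  show ?thesis
  proof (cases "j = 0")
    case True
    then show ?thesis using fin by (simp add: j_def)
  next
    case False
    have r: "card (B - {1..j}) = card ({1..j} - B)"
      using card_Diff_subset_Int[of B "{1..j}"] card_Diff_subset_Int[of "{1..j}" B] fin
      by (simp add: Int_commute j_def)
    have "sum x (B - {1..j}) \<le> of_nat (card (B - {1..j})) * x j"
    proof (rule sum_bounded_above)
      fix i assume "i \<in> B - {1..j}"
      then show "x i \<le> x j"
        using B jn False by (intro monotone_onD[OF x]) auto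
    qed
    moreover have "sum x ({1..j} - B) \<ge> of_nat (card ({1..j} - B)) * x j"
    proof (rule sum_bounded_below)
      fix i assume "i \<in> {1..j} - B"
      then show "x j \<le> x i"
        using jn False by (intro monotone_onD[OF x]) auto
    qed
    moreover have "sum x B = sum x (B \<inter> {1..j}) + sum x (B - {1..j})"
      using fin by (rule sum.Int_Diff)
    moreover have "sum x {1..j} = sum x (B \<inter> {1..j}) + sum x ({1..j} - B)"
      using sum.Int_Diff[of "{1..j}" x B] by (simp add: Int_commute)
    ultimately show ?thesis
      using r by (simp add: j_def)
  qed
qed

text \<open>By Rado's theorem this is the permutohedron when \<open>x\<^sub>1 \<ge> \<dots> \<ge> x\<^sub>n\<close>.\<close>

definition rado :: "nat \<Rightarrow> (nat \<Rightarrow> real) \<Rightarrow> (nat \<Rightarrow> real) set" where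
  "rado n x = {t \<in> extensional {1..n}. (\<forall>A\<subseteq>{1..n}. sum t A \<le> sum x {1..card A}) \<and>
    sum t {1..n} = sum x {1..n}}"

lemma convex_comb_const: "u + v = 1 \<Longrightarrow> u * a + v * a = (a :: real)"
  by (simp flip: distrib_right)

lemma convex_rado: "convex (rado n x)"
proof (rule convexI)
  fix s t :: "nat \<Rightarrow> real" and u v :: real
  assume st: "s \<in> rado n x" "t \<in> rado n x" and uv: "0 \<le> u" "0 \<le> v" "u + v = 1"
  have eq: "(u *\<^sub>R s + v *\<^sub>R t) i = u * s i + v * t i" for i
    by (simp add: scaleR_fun_def plus_fun_def)
  have sum_eq: "sum (u *\<^sub>R s + v *\<^sub>R t) A = u * sum s A + v * sum t A" for A
    unfolding sum_distrib_left sum.distrib[symmetric] by (rule sum.cong[OF refl eq])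
  have const: "u * a + v * a = a" for a :: real
    using uv(3) by (rule convex_comb_const)
  have ext: "u *\<^sub>R s + v *\<^sub>R t \<in> extensional {1..n}"
    unfolding extensional_def mem_Collect_eq eq
  proof (intro allI impI)
    fix i assume "i \<notin> {1..n}"
    then have "s i = undefined" "t i = undefined"
      using st unfolding rado_def by (blast intro: extensional_arb)+
    then show "u * s i + v * t i = undefined"
      by (simp only: const)
  qed
  have total: "sum (u *\<^sub>R s + v *\<^sub>R t) {1..n} = sum x {1..n}"
    using st by (simp only: sum_eq rado_def mem_Collect_eq const)
  have le: "sum (u *\<^sub>R s + v *\<^sub>R t) A \<le> sum x {1..card A}" if "A \<subseteq> {1..n}" for A
  proof -
    have "sum s A \<le> sum x {1..card A}" "sum t A \<le> sum x {1..card A}"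
      using st that unfolding rado_def by blast+
    then have "u * sum s A + v * sum t A \<le> u * sum x {1..card A} + v * sum x {1..card A}"
      using uv by (intro add_mono mult_left_mono)
    then show ?thesis
      unfolding sum_eq const .
  qed
  show "u *\<^sub>R s + v *\<^sub>R t \<in> rado n x"
    unfolding rado_def mem_Collect_eq using ext total le by blast
qed

text \<open>The easy half of Rado's theorem: the inequalities define a convex set and hold at the
  generating points, since no choice of parameters beats the largest ones.\<close>

lemma permutohedron_subset_rado:
  assumes x: "antimono_on {1..n} x"
  shows "permutohedron n x \<subseteq> rado n x"
  unfolding permutohedron_def
proof (rule hull_minimal)
  show "convex (rado n x)"
    by (rule convex_rado)
  show "{\<lambda>i\<in>{1..n}. x (w i) |w. w permutes {1..n}} \<subseteq> rado n x"
  proof clarify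
    fix w assume w: "w permutes {1..n}"
    have s: "sum (\<lambda>i\<in>{1..n}. x (w i)) A = sum x (w ` A)" if "A \<subseteq> {1..n}" for A
    proof -
      have "sum (\<lambda>i\<in>{1..n}. x (w i)) A = (\<Sum>i\<in>A. x (w i))"
        using that by (intro sum.cong) auto
      also have "\<dots> = sum x (w ` A)"
        using permutes_inj_on[OF w] by (simp add: sum.reindex)
      finally show ?thesis .
    qed
    show "(\<lambda>i\<in>{1..n}. x (w i)) \<in> rado n x"
      unfolding rado_def
    proof (intro CollectI conjI allI impI)
      fix A assume A: "A \<subseteq> {1..n}"
      have "card (w ` A) = card A"
        using permutes_inj_on[OF w] by (rule card_image)
      then show "sum (\<lambda>i\<in>{1..n}. x (w i)) A \<le> sum x {1..card A}"
        using antimono_sum_le[OF x, of "w ` A"] s[OF A] permutes_image[OF w] A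
        by (metis image_mono)
    next
      show "sum (\<lambda>i\<in>{1..n}. x (w i)) {1..n} = sum x {1..n}"
        using s[OF order_refl] unfolding permutes_image[OF w] .
      show "(\<lambda>i\<in>{1..n}. x (w i)) \<in> extensional {1..n}"
        by (rule restrict_extensional)
    qed
  qed
qed

section \<open>Merging two parameters: slices at a fixed last coordinate\<close>

lemma sum_merge:
  fixes x :: "nat \<Rightarrow> real"
  assumes "k \<ge> 1"
  shows "sum ((x \<circ> skip k)(k := x k + x (Suc k) - s)) {1..j}
    = (if j < k then sum x {1..j} else sum x {1..Suc j} - s)"
  using assms by (induction j) (auto simp: skip_def less_Suc_eq)

text \<open>The merged parameter again lies between \<open>x (Suc k)\<close> and \<open>x k\<close>,
  so it fits between its neighbours.\<close>

lemma antimono_merge: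
  fixes x :: "nat \<Rightarrow> real"
  assumes x: "antimono_on {1..Suc n} x" and k: "k \<in> {1..n}" and s: "x (Suc k) \<le> s" "s \<le> x k"
  shows "antimono_on {1..n} ((x \<circ> skip k)(k := x k + x (Suc k) - s))"
proof (rule monotone_onI)
  fix i j assume ij: "i \<in> {1..n}" "j \<in> {1..n}" "i \<le> j"
  have le: "x b \<le> x a" if "1 \<le> a" "a \<le> b" "b \<le> Suc n" for a b
    using that by (intro monotone_onD[OF x]) auto
  consider "i = k" "j = k" | "i = k" "j > k" | "i < k" "j = k" | "i \<noteq> k" "j \<noteq> k"
    using ij by linarith
  then show "((x \<circ> skip k)(k := x k + x (Suc k) - s)) j \<le> ((x \<circ> skip k)(k := x k + x (Suc k) - s)) i"
  proof cases
    case 2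
    then show ?thesis using le[of "Suc k" "Suc j"] s k ij by (auto simp: skip_def)
  next
    case 3
    then show ?thesis using le[of i k] s k ij by (auto simp: skip_def)
  next
    case 4
    then show ?thesis using ij by (auto simp: skip_def intro!: le)
  qed auto
qed

text \<open>By \<open>sum_merge\<close>, the bound required for \<open>A\<close> is the inequality
  for \<open>A\<close> itself if \<open>card A < k\<close>, and otherwise the inequality for
  \<open>insert (Suc n) A\<close> with the last coordinate subtracted.\<close>

lemma rado_slice:
  assumes t: "t \<in> rado (Suc n) x" and k: "k \<in> {1..n}"
  shows "restrict t {1..n} \<in> rado n ((x \<circ> skip k)(k := x k + x (Suc k) - t (Suc n)))"
proof -
  let ?y = "(x \<circ> skip k)(k := x k + x (Suc k) - t (Suc n))"
  have le: "sum t A \<le> sum x {1..card A}" if "A \<subseteq> {1..Suc n}" for A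
    using t that by (auto simp: rado_def)
  have r: "sum (restrict t {1..n}) A = sum t A" if "A \<subseteq> {1..n}" for A
    using that by (intro sum.cong) auto
  show ?thesis
    unfolding rado_def
  proof (intro CollectI conjI allI impI)
    fix A assume A: "A \<subseteq> {1..n}"
    then have fin: "finite A" and nA: "Suc n \<notin> A"
      using finite_subset by auto
    have "sum t A + t (Suc n) \<le> sum x {1..Suc (card A)}"
    proof -
      have "insert (Suc n) A \<subseteq> {1..Suc n}"
        using A by force
      from le[OF this] show ?thesis
        using fin nA by (simp add: add.commute)
    qed
    moreover have "sum t A \<le> sum x {1..card A}"
      by (rule le) (use A in auto)
    ultimately show "sum (restrict t {1..n}) A \<le> sum ?y {1..card A}"
      using sum_merge[of k x "t (Suc n)" "card A"] r[OF A] k by auto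
  next
    show "sum (restrict t {1..n}) {1..n} = sum ?y {1..n}"
      using t sum_merge[of k x "t (Suc n)" n] k r[of "{1..n}"] by (auto simp: rado_def)
  qed auto
qed

lemma rado_last_bounds:
  assumes t: "t \<in> rado (Suc n) x"
  shows "x (Suc n) \<le> t (Suc n)" "t (Suc n) \<le> x 1"
proof -
  have le: "sum t A \<le> sum x {1..card A}" if "A \<subseteq> {1..Suc n}" for A
    using t that by (auto simp: rado_def)
  show "t (Suc n) \<le> x 1"
    using le[of "{Suc n}"] by simp
  have "sum t {1..n} \<le> sum x {1..n}"
    using le[of "{1..n}"] by auto
  then show "x (Suc n) \<le> t (Suc n)"
    using t by (auto simp: rado_def)
qed

text \<open>If \<open>s = (1 - a) * x (Suc k) + a * x k\<close>, then the merged parameter is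
  \<open>(1 - a) * x k + a * x (Suc k)\<close>. Hence a generating point of the slice, extended by
  \<open>s\<close>, is a convex combination of two points that differ by exchanging
  \<open>x k\<close> and \<open>x (Suc k)\<close>.\<close>

lemma permutohedron_join:
  assumes k: "k \<in> {1..n}" and s: "x (Suc k) \<le> s" "s \<le> x k"
    and t: "t \<in> permutohedron n ((x \<circ> skip k)(k := x k + x (Suc k) - s))"
  shows "t(Suc n := s) \<in> permutohedron (Suc n) x"
proof -
  let ?y = "(x \<circ> skip k)(k := x k + x (Suc k) - s)"
  obtain a where a: "0 \<le> a" "a \<le> 1" "s = (1 - a) * x (Suc k) + a * x k"
  proof -
    have "s \<in> closed_segment (x (Suc k)) (x k)"
      using s by (simp add: closed_segment_eq_real_ivl)
    then show ?thesis using that by (auto simp: in_segment)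
  qed
  have conv: "convex (permutohedron (Suc n) x)"
    by (simp add: permutohedron_def)
  \<comment> \<open>Appending a fixed coordinate respects convex combinations, so generating points
    suffice.\<close>
  have "permutohedron n ?y \<subseteq> {t. t(Suc n := s) \<in> permutohedron (Suc n) x}"
    unfolding permutohedron_def[of n]
  proof (rule hull_minimal)
    show "convex {t. t(Suc n := s) \<in> permutohedron (Suc n) x}"
    proof (rule convexI)
      fix t t' :: "nat \<Rightarrow> real" and u v :: real
      assume tt: "t \<in> {t. t(Suc n := s) \<in> permutohedron (Suc n) x}"
        "t' \<in> {t. t(Suc n := s) \<in> permutohedron (Suc n) x}" and uv: "0 \<le> u" "0 \<le> v" "u + v = 1"
      have "(u *\<^sub>R t + v *\<^sub>R t')(Suc n := s) = u *\<^sub>R t(Suc n := s) + v *\<^sub>R t'(Suc n := s)"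
        using uv by (auto simp: fun_eq_iff scaleR_fun_def plus_fun_def distrib_right[symmetric])
      then show "u *\<^sub>R t + v *\<^sub>R t' \<in> {t. t(Suc n := s) \<in> permutohedron (Suc n) x}"
        using convexD[OF conv] tt uv by simp
    qed
    show "{\<lambda>i\<in>{1..n}. ?y (w i) |w. w permutes {1..n}} \<subseteq> {t. t(Suc n := s) \<in> permutohedron (Suc n) x}"
    proof clarify
      fix w assume w: "w permutes {1..n}"
      have w': "w permutes {1..Suc n}"
        using permutes_fix_last w by blast
      have ws: "w (Suc n) = Suc n"
        using permutes_fix_last w by blast
      \<comment> \<open>\<open>V p\<close> has last coordinate \<open>x p\<close> and distributes
        the other parameters according to \<open>w\<close>.\<close>
      define V where "V p = (\<lambda>i\<in>{1..Suc n}. x ((cyc n p \<circ> w) i))" for p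
      have V: "V p \<in> permutohedron (Suc n) x" if "p \<in> {1..Suc n}" for p
        unfolding permutohedron_def V_def
        by (rule hull_inc) (use permutes_compose[OF w' cyc_permutes[OF that]] in blast)
      have "(\<lambda>i\<in>{1..n}. ?y (w i))(Suc n := s) = (1 - a) *\<^sub>R V (Suc k) + a *\<^sub>R V k"
      proof
        fix i
        have wi: "w i \<in> {1..n}" if "i \<in> {1..n}"
          using permutes_in_image[OF w] that by blast
        consider "i = Suc n" | "i \<in> {1..n}" "w i = k" | "i \<in> {1..n}" "w i \<noteq> k" | "i \<notin> {1..Suc n}"
          by force
        then show "((\<lambda>i\<in>{1..n}. ?y (w i))(Suc n := s)) i = ((1 - a) *\<^sub>R V (Suc k) + a *\<^sub>R V k) i"
        proof cases
          case 1
          then show ?thesis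
            using a(3) by (simp add: scaleR_fun_def plus_fun_def V_def ws cyc_def)
        next
          case 2
          then show ?thesis
            using a(3) k by (auto simp: scaleR_fun_def plus_fun_def V_def cyc_def skip_def algebra_simps)
        next
          case 3
          then have "skip (Suc k) (w i) = skip k (w i)" "w i \<noteq> Suc n"
            using wi by (auto simp: skip_def)
          then show ?thesis
            using 3 wi by (simp add: scaleR_fun_def plus_fun_def V_def cyc_def algebra_simps)
        next
          case 4
          \<comment> \<open>Both points are \<open>undefined\<close> here, and the weights add up to
            1.\<close>
          then show ?thesis
            by (auto simp: scaleR_fun_def plus_fun_def V_def algebra_simps)
        qed
      qed
      also have "\<dots> \<in> permutohedron (Suc n) x"
        using convexD[OF conv V V, of "Suc k" k "1 - a" a] a k by auto
      finally show "(\<lambda>i\<in>{1..n}. ?y (w i))(Suc n := s) \<in> permutohedron (Suc n) x" .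
    qed
  qed
  then show ?thesis
    using t by blast
qed

lemma rado_find_interval:
  fixes x :: "nat \<Rightarrow> real"
  assumes "n \<ge> 1" "x (Suc n) \<le> s" "s \<le> x 1"
  shows "\<exists>k\<in>{1..n}. x (Suc k) \<le> s \<and> s \<le> x k"
  using assms
proof (induction n)
  case (Suc n)
  show ?case
  proof (cases "n = 0 \<or> s \<le> x (Suc n)")
    case True
    then show ?thesis using Suc.prems by (intro bexI[of _ "Suc n"]) auto
  next
    case False
    then have "\<exists>k\<in>{1..n}. x (Suc k) \<le> s \<and> s \<le> x k"
      using Suc.prems by (intro Suc.IH) auto
    then show ?thesis
      by auto
  qed
qed simp

text \<open>Rado's theorem by induction: fixing the last coordinate leads to the inequalities of a
  merged sequence, the induction hypothesis makes the slice a permutohedron, and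
  \<open>permutohedron_join\<close> restores the coordinate.\<close>

lemma permutohedron_eq_rado:
  assumes "n \<ge> 1" "antimono_on {1..n} x"
  shows "permutohedron n x = rado n x"
proof
  show "permutohedron n x \<subseteq> rado n x"
    using assms(2) by (rule permutohedron_subset_rado)
  show "rado n x \<subseteq> permutohedron n x"
    using assms
  proof (induction n arbitrary: x rule: dec_induct)
    case base
    show ?case
    proof
      fix t assume t: "t \<in> rado 1 x"
      then have "t = (\<lambda>i\<in>{1..1}. x (id i))"
        by (auto simp: rado_def extensional_def fun_eq_iff)
      then show "t \<in> permutohedron 1 x"
        unfolding permutohedron_def by (intro hull_inc) (use permutes_id in blast)
    qed
  next
    case (step n)
    show ?case
    proof
      fix t assume t: "t \<in> rado (Suc n) x"
      obtain k where k: "k \<in> {1..n}" "x (Suc k) \<le> t (Suc n)" "t (Suc n) \<le> x k"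
        using rado_find_interval[of n x "t (Suc n)"] rado_last_bounds[OF t] step.hyps by auto
      have "restrict t {1..n} \<in> permutohedron n ((x \<circ> skip k)(k := x k + x (Suc k) - t (Suc n)))"
        using step.IH[OF antimono_merge[OF step.prems k]] rado_slice[OF t k(1)] by blast
      then have "(restrict t {1..n})(Suc n := t (Suc n)) \<in> permutohedron (Suc n) x"
        by (rule permutohedron_join[OF k])
      moreover have "(restrict t {1..n})(Suc n := t (Suc n)) = t"
        using t by (auto simp: rado_def extensional_def fun_eq_iff le_Suc_eq)
      ultimately show "t \<in> permutohedron (Suc n) x"
        by simp
    qed
  qed
qed

text \<open>The converse of \<open>rado_slice\<close> passes through permutohedra, where extending a
  slice is a matter of convexity.\<close>

lemma rado_slice_iff:
  assumes x: "antimono_on {1..Suc n} x" and k: "k \<in> {1..n}" "x (Suc k) \<le> s" "s \<le> x k"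
    and t: "t \<in> extensional {1..n}"
  shows "t(Suc n := s) \<in> rado (Suc n) x \<longleftrightarrow> t \<in> rado n ((x \<circ> skip k)(k := x k + x (Suc k) - s))"
proof
  assume L: "t(Suc n := s) \<in> rado (Suc n) x"
  have "restrict (t(Suc n := s)) {1..n} = t"
    using t by (auto simp: extensional_def fun_eq_iff)
  then show "t \<in> rado n ((x \<circ> skip k)(k := x k + x (Suc k) - s))"
    using rado_slice[OF L k(1)] by simp
next
  assume "t \<in> rado n ((x \<circ> skip k)(k := x k + x (Suc k) - s))"
  then have "t \<in> permutohedron n ((x \<circ> skip k)(k := x k + x (Suc k) - s))"
    using permutohedron_eq_rado[OF _ antimono_merge[OF x k]] k(1) by auto
  then show "t(Suc n := s) \<in> rado (Suc n) x"
    using permutohedron_join[OF k] permutohedron_subset_rado[OF x] by blast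
qed

section \<open>The projection along the last coordinate\<close>

lemma rado_permute:
  assumes w: "w permutes {1..n}" and t: "t \<in> rado n x"
  shows "t \<circ> w \<in> rado n x"
  unfolding rado_def
proof (intro CollectI conjI allI impI)
  have s: "sum (t \<circ> w) A = sum t (w ` A)" for A
    using permutes_inj_on[OF w] by (simp add: sum.reindex)
  show "t \<circ> w \<in> extensional {1..n}"
    using t permutes_not_in[OF w] by (auto simp: rado_def extensional_def)
  show "sum (t \<circ> w) {1..n} = sum x {1..n}"
    unfolding s permutes_image[OF w] using t by (simp add: rado_def)
  fix A assume A: "A \<subseteq> {1..n}"
  have "w ` A \<subseteq> {1..n}" "card (w ` A) = card A"
    using image_mono[OF A, of w] unfolding permutes_image[OF w]
    by (simp_all add: card_image permutes_inj_on[OF w])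
  then show "sum (t \<circ> w) A \<le> sum x {1..card A}"
    unfolding s using t by (auto simp: rado_def dest: spec[of _ "w ` A"])
qed

text \<open>The image of \<open>rado (Suc n) x\<close> in implicit form: the forgotten coordinate is
  recovered from the total. Points have n coordinates, while n + 1 parameters enter.\<close>

definition proj :: "nat \<Rightarrow> (nat \<Rightarrow> real) \<Rightarrow> (nat \<Rightarrow> real) set" where
  "proj n x = {u \<in> extensional {1..n}. u(Suc n := sum x {1..Suc n} - sum u {1..n}) \<in> rado (Suc n) x}"

lemma restrict_rado: "(\<lambda>t. restrict t {1..n}) ` rado (Suc n) x = proj n x"
proof
  show "(\<lambda>t. restrict t {1..n}) ` rado (Suc n) x \<subseteq> proj n x"
  proof clarify
    fix t assume t: "t \<in> rado (Suc n) x"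
    have "sum (restrict t {1..n}) {1..n} = sum t {1..n}"
      by (rule sum.cong) auto
    then have "(restrict t {1..n})(Suc n := sum x {1..Suc n} - sum (restrict t {1..n}) {1..n}) = t"
      using t by (auto simp: rado_def extensional_def fun_eq_iff le_Suc_eq)
    then show "restrict t {1..n} \<in> proj n x"
      using t by (simp add: proj_def)
  qed
  show "proj n x \<subseteq> (\<lambda>t. restrict t {1..n}) ` rado (Suc n) x"
  proof
    fix u assume u: "u \<in> proj n x"
    then show "u \<in> (\<lambda>t. restrict t {1..n}) ` rado (Suc n) x"
      by (intro image_eqI[where x = "u(Suc n := sum x {1..Suc n} - sum u {1..n})"])
        (auto simp: proj_def extensional_def fun_eq_iff)
  qed
qed

lemma proj_0: "proj 0 x = {\<lambda>_. undefined}"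
proof -
  have "(\<lambda>_. undefined)(Suc 0 := x (Suc 0)) \<in> rado (Suc 0) x"
  proof -
    have "sum ((\<lambda>_. undefined)(Suc 0 := x (Suc 0))) A \<le> sum x {1..card A}" if "A \<subseteq> {1..Suc 0}" for A
    proof -
      have "A = {} \<or> A = {Suc 0}"
        using that by auto
      then show ?thesis
        by auto
    qed
    then show ?thesis
      by (simp add: rado_def extensional_def)
  qed
  then show ?thesis
    by (auto simp: proj_def)
qed

text \<open>The fixed coordinate n + 1 is not the last one of the polytope, so it is first swapped
  with coordinate n + 2 by symmetry; then \<open>rado_slice_iff\<close> applies.\<close>

lemma proj_slice_iff:
  assumes x: "antimono_on {1..Suc (Suc n)} x" and k: "k \<in> {1..Suc n}" "x (Suc k) \<le> s" "s \<le> x k"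
    and u: "u \<in> extensional {1..n}"
  shows "u(Suc n := s) \<in> proj (Suc n) x \<longleftrightarrow> u \<in> proj n ((x \<circ> skip k)(k := x k + x (Suc k) - s))"
proof -
  let ?y = "(x \<circ> skip k)(k := x k + x (Suc k) - s)"
  \<comment> \<open>The recovered coordinate is the same on both sides, because merging lowers the
    total of the parameters by \<open>s\<close>.\<close>
  define r where "r = sum x {1..Suc (Suc n)} - sum u {1..n} - s"
  let ?\<tau> = "Transposition.transpose (Suc n) (Suc (Suc n))"
  have \<tau>: "?\<tau> permutes {1..Suc (Suc n)}"
    by (rule permutes_swap_id) auto
  have su: "sum (u(Suc n := s)) {1..n} = sum u {1..n}"
    by (rule sum.cong) auto
  have r1: "sum x {1..Suc (Suc n)} - sum (u(Suc n := s)) {1..Suc n} = r"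
    using su by (simp add: r_def)
  have r2: "sum ?y {1..Suc n} - sum u {1..n} = r"
    using sum_merge[of k x s "Suc n"] k by (auto simp: r_def)
  have swap: "u(Suc n := a, Suc (Suc n) := b) \<circ> ?\<tau> = u(Suc n := b, Suc (Suc n) := a)" for a b
    by (auto simp: fun_eq_iff Transposition.transpose_def)
  have ext: "u(Suc n := s) \<in> extensional {1..Suc n}"
    using u by (auto simp: extensional_def)
  have "u(Suc n := s) \<in> proj (Suc n) x \<longleftrightarrow> u(Suc n := s, Suc (Suc n) := r) \<in> rado (Suc (Suc n)) x"
    unfolding proj_def mem_Collect_eq r1 using ext by blast
  also have "\<dots> \<longleftrightarrow> u(Suc n := r, Suc (Suc n) := s) \<in> rado (Suc (Suc n)) x"
    using rado_permute[OF \<tau>] swap by metis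
  also have "\<dots> \<longleftrightarrow> u(Suc n := r) \<in> rado (Suc n) ?y"
    by (rule rado_slice_iff[OF x k]) (use u in \<open>auto simp: extensional_def\<close>)
  also have "\<dots> \<longleftrightarrow> u \<in> proj n ?y"
    unfolding proj_def mem_Collect_eq r2 using u by blast
  finally show ?thesis .
qed

lemma proj_last_bounds:
  assumes "u(Suc n := s) \<in> proj (Suc n) x"
  shows "x (Suc (Suc n)) \<le> s" "s \<le> x 1"
proof -
  let ?\<tau> = "Transposition.transpose (Suc n) (Suc (Suc n))"
  have \<tau>: "?\<tau> permutes {1..Suc (Suc n)}"
    by (rule permutes_swap_id) auto
  obtain r where "u(Suc n := s, Suc (Suc n) := r) \<in> rado (Suc (Suc n)) x"
    using assms by (auto simp: proj_def)
  from rado_last_bounds[OF rado_permute[OF \<tau> this]] show "x (Suc (Suc n)) \<le> s" "s \<le> x 1"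
    by (auto simp: Transposition.transpose_def)
qed

text \<open>A finite intersection of closed half-spaces: the recovered coordinate makes the equation
  for the total hold automatically.\<close>

lemma proj_measurable: "proj n x \<in> sets (\<Pi>\<^sub>M i\<in>{1..n}. lborel)"
proof -
  let ?M = "\<Pi>\<^sub>M i\<in>{1..n}. (lborel :: real measure)"
  define e where "e u = u(Suc n := sum x {1..Suc n} - sum u {1..n})" for u :: "nat \<Rightarrow> real"
  have sp: "space ?M = extensional {1..n}"
    by (auto simp: space_PiM PiE_def)
  have meas: "(\<lambda>u. e u i) \<in> borel_measurable ?M" if "i \<in> {1..Suc n}" for i
  proof (cases "i = Suc n")
    case True
    have "(\<lambda>u. sum u {1..n}) \<in> borel_measurable ?M"
      by (intro borel_measurable_sum) (auto intro: measurable_component_singleton)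
    then show ?thesis using True by (simp add: e_def)
  next
    case False
    then show ?thesis using that measurable_component_singleton[of i "{1..n}" "\<lambda>_. lborel :: real measure"]
      by (simp add: e_def)
  qed
  have 1: "(\<lambda>u. sum (e u) A) \<in> borel_measurable ?M" if "A \<subseteq> {1..Suc n}" for A
    by (intro borel_measurable_sum meas) (use that in auto)
  have "proj n x = {u \<in> space ?M. \<forall>A\<in>Pow {1..Suc n}. sum (e u) A \<le> sum x {1..card A}}"
  proof -
    have "sum (e u) {1..n} = sum u {1..n}" for u
      by (rule sum.cong) (auto simp: e_def)
    then have "sum (e u) {1..Suc n} = sum x {1..Suc n}" for u
      by (simp add: e_def)
    moreover have "e u \<in> extensional {1..Suc n}" if "u \<in> extensional {1..n}" for u
      using that by (auto simp: e_def extensional_def)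
    ultimately show ?thesis
      unfolding proj_def rado_def e_def[symmetric] sp by auto
  qed
  also have "\<dots> \<in> sets ?M"
    by (intro sets.sets_Collect_finite_All borel_measurable_le 1) auto
  finally show ?thesis .
qed

subsection \<open>The volume polynomial\<close>

lemma finite_exponents: "finite (exponents n)"
proof (rule finite_subset)
  show "exponents n \<subseteq> {1..n} \<rightarrow>\<^sub>E {..n-1}"
  proof
    fix c assume c: "c \<in> exponents n"
    have "c i \<le> n - 1" if "i \<in> {1..n}" for i
      using member_le_sum[OF that, of c] c by (auto simp: exponents_def)
    then show "c \<in> {1..n} \<rightarrow>\<^sub>E {..n-1}"
      using c by (auto simp: exponents_def PiE_iff)
  qed
qed (auto intro: finite_PiE)

section \<open>Merging and splitting exponents\<close>

lemma skip_image_off: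
  assumes "k \<in> {1..n}"
  shows "skip k ` ({1..n} - {k}) = {1..Suc n} - {k, Suc k}"
proof -
  have "skip k ` ({1..n} - {k}) = skip k ` {1..n} - skip k ` {k}"
    by (rule image_set_diff[OF inj_skip])
  also have "skip k ` {1..n} = {1..Suc n} - {k}"
    using skip_image[of k "Suc n"] assms by simp
  also have "skip k ` {k} = {Suc k}"
    by (simp add: skip_def)
  finally show ?thesis
    by blast
qed

lemma sum_split_skip:
  fixes f :: "nat \<Rightarrow> nat"
  assumes k: "k \<in> {1..n}"
  shows "sum f {1..Suc n} = f k + f (Suc k) + (\<Sum>i\<in>{1..n}-{k}. f (skip k i))"
proof -
  have "sum f {1..Suc n} = sum f ({1..Suc n} - {k, Suc k}) + sum f {k, Suc k}"
    using k by (intro sum.subset_diff) auto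
  also have "sum f ({1..Suc n} - {k, Suc k}) = (\<Sum>i\<in>{1..n}-{k}. f (skip k i))"
    unfolding skip_image_off[OF k, symmetric] by (simp add: sum.reindex[OF inj_skip])
  finally show ?thesis
    by simp
qed

lemma prod_split_skip:
  fixes f :: "nat \<Rightarrow> real"
  assumes k: "k \<in> {1..n}"
  shows "prod f {1..Suc n} = f k * f (Suc k) * (\<Prod>i\<in>{1..n}-{k}. f (skip k i))"
proof -
  have "prod f {1..Suc n} = prod f ({1..Suc n} - {k, Suc k}) * prod f {k, Suc k}"
    using k by (intro prod.subset_diff) auto
  also have "prod f ({1..Suc n} - {k, Suc k}) = (\<Prod>i\<in>{1..n}-{k}. f (skip k i))"
    unfolding skip_image_off[OF k, symmetric] by (simp add: prod.reindex[OF inj_skip])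
  finally show ?thesis
    by simp
qed

text \<open>The 1 subtracted at \<open>k\<close> is the degree gained by integration. The lemmas
  ensure \<open>e k + e (Suc k) \<ge> 1\<close>, so the subtraction does not truncate.\<close>

definition merge_exp :: "nat \<Rightarrow> nat \<Rightarrow> (nat \<Rightarrow> nat) \<Rightarrow> nat \<Rightarrow> nat" where
  "merge_exp n k e = (\<lambda>i\<in>{1..n}. if i = k then e k + e (Suc k) - 1 else e (skip k i))"

text \<open>The exponents after integrating in the merged parameter and evaluating at
  \<open>x p\<close>, where \<open>p\<close> is \<open>k\<close> or \<open>Suc k\<close>: the other
  of these two indices, called \<open>q\<close> below, gets exponent 0.\<close>

definition split_exp :: "nat \<Rightarrow> nat \<Rightarrow> nat \<Rightarrow> (nat \<Rightarrow> nat) \<Rightarrow> nat \<Rightarrow> nat" where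
  "split_exp n k p c = (\<lambda>i\<in>{1..Suc n}. if i = p then Suc (c k) else if i = k \<or> i = Suc k then 0
    else c (if i < k then i else i - 1))"

lemma split_exp_apply:
  assumes k: "k \<in> {1..n}" and pq: "p = k \<and> q = Suc k \<or> p = Suc k \<and> q = k"
  shows "split_exp n k p c p = Suc (c k)" "split_exp n k p c q = 0"
    "i \<in> {1..n} - {k} \<Longrightarrow> split_exp n k p c (skip k i) = c i"
  using k pq by (auto simp: split_exp_def skip_def)

lemma split_exp_in:
  assumes k: "k \<in> {1..n}" and pq: "p = k \<and> q = Suc k \<or> p = Suc k \<and> q = k" and c: "c \<in> exponents n"
  shows "split_exp n k p c \<in> exponents (Suc n)"
proof -
  let ?e = "split_exp n k p c"
  have "sum ?e {1..Suc n} = ?e p + ?e q + (\<Sum>i\<in>{1..n}-{k}. ?e (skip k i))"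
    unfolding sum_split_skip[OF k] using pq by auto
  also have "\<dots> = Suc (c k) + (\<Sum>i\<in>{1..n}-{k}. c i)"
    using split_exp_apply[OF k pq] by simp
  also have "\<dots> = Suc (sum c {1..n})"
    using k sum.remove[of "{1..n}" k c] by simp
  also have "\<dots> = n"
    using c k by (simp add: exponents_def)
  finally show ?thesis
    by (simp add: exponents_def split_exp_def)
qed

lemma merge_split_exp:
  assumes k: "k \<in> {1..n}" and pq: "p = k \<and> q = Suc k \<or> p = Suc k \<and> q = k" and c: "c \<in> exponents n"
  shows "merge_exp n k (split_exp n k p c) = c"
proof
  fix i
  have "split_exp n k p c k + split_exp n k p c (Suc k) = Suc (c k)"
    using split_exp_apply(1,2)[OF k pq, of c] pq by auto
  moreover have "c i = undefined" if "i \<notin> {1..n}"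
    using c that unfolding exponents_def by (auto simp: PiE_iff extensional_def)
  ultimately show "merge_exp n k (split_exp n k p c) i = c i"
    using split_exp_apply(3)[OF k pq, of i c] by (auto simp: merge_exp_def)
qed

lemma merge_exp_in:
  assumes k: "k \<in> {1..n}" and e: "e \<in> exponents (Suc n)" "e k + e (Suc k) \<ge> 1"
  shows "merge_exp n k e \<in> exponents n"
proof -
  have "sum (merge_exp n k e) {1..n} = merge_exp n k e k + sum (merge_exp n k e) ({1..n} - {k})"
    using k by (simp add: sum.remove)
  also have "\<dots> = e k + e (Suc k) - 1 + (\<Sum>i\<in>{1..n}-{k}. e (skip k i))"
    using k by (simp add: merge_exp_def)
  also have "\<dots> = sum e {1..Suc n} - 1"
    using e(2) unfolding sum_split_skip[OF k] by simp
  finally show ?thesis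
    using e(1) by (simp add: exponents_def merge_exp_def)
qed

lemma split_merge_exp:
  assumes k: "k \<in> {1..n}" and pq: "p = k \<and> q = Suc k \<or> p = Suc k \<and> q = k"
    and e: "e \<in> exponents (Suc n)" "e q = 0" "e p \<noteq> 0"
  shows "split_exp n k p (merge_exp n k e) = e"
proof
  fix i
  show "split_exp n k p (merge_exp n k e) i = e i"
  proof (cases "i \<in> {1..Suc n}")
    case False
    then show ?thesis
      using e(1) unfolding exponents_def by (auto simp: split_exp_def PiE_iff extensional_def)
  next
    case True
    consider "i = p" | "i = q" | "i < k" | "i > Suc k"
      using pq by linarith
    then show ?thesis
      by cases (use True k pq e(2,3) in \<open>auto simp: split_exp_def merge_exp_def skip_def\<close>)
  qed
qed

text \<open>The analogue of \<open>sum_merge\<close> with 1 in place of \<open>s\<close>; the form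
  with \<open>Suc\<close> avoids subtraction of naturals.\<close>

lemma sum_merge_exp:
  assumes k: "k \<in> {1..n}" and e: "e k + e (Suc k) \<ge> 1" and i: "i \<le> n"
  shows "if i < k then sum (merge_exp n k e) {1..i} = sum e {1..i}
    else Suc (sum (merge_exp n k e) {1..i}) = sum e {1..Suc i}"
  using i
proof (induction i)
  case (Suc i)
  then show ?case
    using k e by (auto simp: merge_exp_def skip_def less_Suc_eq split: if_splits)
qed (use k in auto)

text \<open>From index \<open>k\<close> on, the partial sum and its index both drop by 1 under
  merging, so each strict inequality at \<open>skip k i\<close> becomes the one at
  \<open>i\<close>.\<close>

lemma I_set_merge_exp:
  assumes k: "k \<in> {1..n}" and e: "e \<in> exponents (Suc n)" "e k + e (Suc k) \<ge> 1"
  shows "I_set n (merge_exp n k e) = shrink n k (I_set (Suc n) e)"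
proof -
  have "sum (merge_exp n k e) {1..i} < i \<longleftrightarrow> sum e {1..skip k i} < skip k i"
    if "i \<in> {1..n-1}" for i
  proof -
    have "i \<le> n"
      using that by auto
    from sum_merge_exp[OF k e(2) this] show ?thesis
      by (auto simp: skip_def simp del: sum.cl_ivl_Suc split: if_splits)
  qed
  moreover have "skip k i \<in> {1..n}" if "i \<in> {1..n-1}" for i
    using that by (auto simp: skip_def)
  moreover have "I_set n (merge_exp n k e) = {i \<in> {1..n-1}. sum (merge_exp n k e) {1..i} < i}"
    using merge_exp_in[OF k e] by (intro I_set_eq) (simp add: exponents_def)
  moreover have "I_set (Suc n) e = {i \<in> {1..n}. sum e {1..i} < i}"
    using I_set_eq[of e "Suc n"] e(1) by (simp add: exponents_def)
  ultimately show ?thesis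
    unfolding shrink_def by blast
qed

section \<open>The polynomial and its antiderivatives\<close>

definition monomial :: "nat \<Rightarrow> (nat \<Rightarrow> nat) \<Rightarrow> (nat \<Rightarrow> real) \<Rightarrow> real" where
  "monomial n c x = (\<Prod>i=1..n. x i ^ c i / fact (c i))"

definition vol_poly :: "nat \<Rightarrow> (nat \<Rightarrow> real) \<Rightarrow> real" where
  "vol_poly n x = (\<Sum>c\<in>exponents n. signed_D n (I_set n c) * monomial n c x)"

text \<open>The antiderivative, vanishing at \<open>u = 0\<close>, of \<open>vol_poly n\<close> as a
  function of its k-th parameter \<open>u\<close>, the others being taken from \<open>x\<close> by
  \<open>skip k\<close>.\<close>

definition antideriv :: "nat \<Rightarrow> nat \<Rightarrow> (nat \<Rightarrow> real) \<Rightarrow> real \<Rightarrow> real" where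
  "antideriv n k x u = (\<Sum>c\<in>exponents n. signed_D n (I_set n c) *
    ((\<Prod>i\<in>{1..n}-{k}. x (skip k i) ^ c i / fact (c i)) * (u ^ Suc (c k) / fact (Suc (c k)))))"

lemma vol_poly_merge:
  assumes k: "k \<in> {1..n}"
  shows "vol_poly n ((x \<circ> skip k)(k := u)) = (\<Sum>c\<in>exponents n. signed_D n (I_set n c) *
    ((\<Prod>i\<in>{1..n}-{k}. x (skip k i) ^ c i / fact (c i)) * (u ^ c k / fact (c k))))"
proof -
  have "monomial n c ((x \<circ> skip k)(k := u))
      = (\<Prod>i\<in>{1..n}-{k}. x (skip k i) ^ c i / fact (c i)) * (u ^ c k / fact (c k))" for c
  proof -
    have "monomial n c ((x \<circ> skip k)(k := u)) = (u ^ c k / fact (c k)) *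
        (\<Prod>i\<in>{1..n}-{k}. ((x \<circ> skip k)(k := u)) i ^ c i / fact (c i))"
      unfolding monomial_def using k by (subst prod.remove[of _ k]) auto
    also have "(\<Prod>i\<in>{1..n}-{k}. ((x \<circ> skip k)(k := u)) i ^ c i / fact (c i))
        = (\<Prod>i\<in>{1..n}-{k}. x (skip k i) ^ c i / fact (c i))"
      by (rule prod.cong) auto
    finally show ?thesis
      by (simp only: mult.commute)
  qed
  then show ?thesis
    by (simp only: vol_poly_def)
qed

lemma has_real_derivative_antideriv:
  assumes k: "k \<in> {1..n}"
  shows "(antideriv n k x has_real_derivative vol_poly n ((x \<circ> skip k)(k := u))) (at u)"
proof -
  have "((\<lambda>u. u ^ Suc m / fact (Suc m)) has_real_derivative u ^ m / fact m) (at u)" for m and u :: real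
  proof -
    have "((\<lambda>u. u ^ Suc m / fact (Suc m)) has_real_derivative (1 + real m) * u ^ m / fact (Suc m)) (at u)"
      by (rule DERIV_cdivide) (use DERIV_pow[of "Suc m" u] in simp)
    also have "(1 + real m) * u ^ m / fact (Suc m) = u ^ m / fact m"
    proof -
      have "1 + real m \<noteq> 0"
        by simp
      then show ?thesis
        unfolding fact_Suc of_nat_Suc by (rule mult_divide_mult_cancel_left)
    qed
    finally show ?thesis .
  qed
  then show ?thesis
    unfolding vol_poly_merge[OF k] antideriv_def by (intro DERIV_sum DERIV_cmult)
qed

text \<open>Thanks to the divided powers, evaluation at \<open>x p\<close> turns the term of
  \<open>c\<close> into the monomial of \<open>split_exp n k p c\<close> with unchanged coefficient.
  Splitting and merging are inverse bijections onto the exponents with \<open>e q = 0\<close> and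
  \<open>e p \<noteq> 0\<close>.\<close>

lemma antideriv_eq_sum:
  assumes k: "k \<in> {1..n}" and pq: "p = k \<and> q = Suc k \<or> p = Suc k \<and> q = k"
  shows "antideriv n k x (x p) = (\<Sum>e\<in>exponents (Suc n).
    of_bool (e q = 0 \<and> e p \<noteq> 0) * (signed_D n (shrink n k (I_set (Suc n) e)) * monomial (Suc n) e x))"
proof -
  let ?E = "{e \<in> exponents (Suc n). e q = 0 \<and> e p \<noteq> 0}"
  have pos: "e k + e (Suc k) \<ge> 1" if "e p \<noteq> 0" for e :: "nat \<Rightarrow> nat"
    using pq that by auto
  have "antideriv n k x (x p) = (\<Sum>e\<in>?E. signed_D n (shrink n k (I_set (Suc n) e)) * monomial (Suc n) e x)"
    unfolding antideriv_def
  proof (rule sum.reindex_bij_witness[of _ "merge_exp n k" "split_exp n k p"])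
    fix c assume c: "c \<in> exponents n"
    let ?e = "split_exp n k p c"
    note e = split_exp_apply[OF k pq, where c = c]
    show "merge_exp n k ?e = c"
      by (rule merge_split_exp[OF k pq c])
    show mem: "?e \<in> ?E"
      using split_exp_in[OF k pq c] e by simp
    have I: "I_set n c = shrink n k (I_set (Suc n) ?e)"
      using I_set_merge_exp[OF k split_exp_in[OF k pq c] pos] mem merge_split_exp[OF k pq c] by simp
    have "monomial (Suc n) ?e x = x p ^ ?e p / fact (?e p) * (x q ^ ?e q / fact (?e q)) *
        (\<Prod>i\<in>{1..n}-{k}. x (skip k i) ^ ?e (skip k i) / fact (?e (skip k i)))"
      unfolding monomial_def prod_split_skip[OF k] using pq by (auto simp: mult.commute)
    also have "\<dots> = (\<Prod>i\<in>{1..n}-{k}. x (skip k i) ^ c i / fact (c i)) *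
        (x p ^ Suc (c k) / fact (Suc (c k)))"
      using e by (simp add: mult.commute del: fact_Suc power_Suc)
    finally show "signed_D n (shrink n k (I_set (Suc n) ?e)) * monomial (Suc n) ?e x =
        signed_D n (I_set n c) * ((\<Prod>i\<in>{1..n}-{k}. x (skip k i) ^ c i / fact (c i)) *
        (x p ^ Suc (c k) / fact (Suc (c k))))"
      using I by (simp only:)
  next
    fix e assume e: "e \<in> ?E"
    then show "split_exp n k p (merge_exp n k e) = e" "merge_exp n k e \<in> exponents n"
      using split_merge_exp[OF k pq, of e] merge_exp_in[OF k, of e] pos[of e] by blast+
  qed
  also have "\<dots> = (\<Sum>e\<in>exponents (Suc n).
    of_bool (e q = 0 \<and> e p \<noteq> 0) * (signed_D n (shrink n k (I_set (Suc n) e)) * monomial (Suc n) e x))"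
    by (rule sum.mono_neutral_cong_left) (auto simp: finite_exponents)
  finally show ?thesis .
qed

text \<open>After exchanging the sums, comparison of the coefficients of each monomial is
  \<open>signed_D_rec\<close>.\<close>

lemma vol_poly_rec:
  assumes n: "n \<ge> 1"
  shows "vol_poly (Suc n) x = (\<Sum>k=1..n. antideriv n k x (x k) - antideriv n k x (x (Suc k)))"
proof -
  let ?f = "\<lambda>k e. signed_D n (shrink n k (I_set (Suc n) e))"
  have "(\<Sum>k=1..n. antideriv n k x (x k) - antideriv n k x (x (Suc k))) =
      (\<Sum>k=1..n. \<Sum>e\<in>exponents (Suc n). (of_bool (e (Suc k) = 0) - of_bool (e k = 0)) * ?f k e * monomial (Suc n) e x)"
  proof (rule sum.cong[OF refl])
    fix k assume k: "k \<in> {1..n}"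
    have "antideriv n k x (x k) = (\<Sum>e\<in>exponents (Suc n).
        of_bool (e (Suc k) = 0 \<and> e k \<noteq> 0) * (?f k e * monomial (Suc n) e x))"
      by (rule antideriv_eq_sum[OF k]) simp
    moreover have "antideriv n k x (x (Suc k)) = (\<Sum>e\<in>exponents (Suc n).
        of_bool (e k = 0 \<and> e (Suc k) \<noteq> 0) * (?f k e * monomial (Suc n) e x))"
      by (rule antideriv_eq_sum[OF k]) simp
    ultimately show "antideriv n k x (x k) - antideriv n k x (x (Suc k)) =
        (\<Sum>e\<in>exponents (Suc n). (of_bool (e (Suc k) = 0) - of_bool (e k = 0)) * ?f k e * monomial (Suc n) e x)"
      \<comment> \<open>The case in which both exponents vanish cancels in the difference of the
        indicators.\<close>
      by (simp add: sum_subtractf[symmetric]) (rule sum.cong, auto)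
  qed
  also have "\<dots> = (\<Sum>e\<in>exponents (Suc n). (\<Sum>k=1..n. (of_bool (e (Suc k) = 0) - of_bool (e k = 0)) * ?f k e) * monomial (Suc n) e x)"
    by (subst sum.swap) (simp only: sum_distrib_right)
  also have "\<dots> = vol_poly (Suc n) x"
    unfolding vol_poly_def
  proof (rule sum.cong[OF refl])
    fix e assume "e \<in> exponents (Suc n)"
    then have "sum e {1..Suc n} = n"
      by (simp add: exponents_def)
    then show "(\<Sum>k=1..n. (of_bool (e (Suc k) = 0) - of_bool (e k = 0)) * ?f k e) * monomial (Suc n) e x
        = signed_D (Suc n) (I_set (Suc n) e) * monomial (Suc n) e x"
      using signed_D_rec[OF n, of e] by (simp only:)
  qed
  finally show ?thesis ..
qed

lemma vol_poly_1: "vol_poly (Suc 0) x = 1"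
proof -
  have E: "exponents (Suc 0) = {\<lambda>i\<in>{1..Suc 0}. 0}"
    by (auto simp: exponents_def PiE_iff extensional_def fun_eq_iff)
  have I: "I_set (Suc 0) c = {}" for c
    by (simp add: I_set_def)
  have P: "w permutes {1..Suc 0} \<longleftrightarrow> w = id" for w
    by (simp add: permutes_sing)
  have "{w. w permutes {1..Suc 0} \<and> descent_set (Suc 0) w = {}} = {id}"
    unfolding P by (auto simp: descent_set_def)
  then have "D (Suc 0) {} = 1"
    by (simp only: D_def) simp
  then show ?thesis
    by (simp add: vol_poly_def E I signed_D_def monomial_def)
qed

section \<open>Integration over slices\<close>

lemma borel_measurable_vol_poly_merge:
  assumes k: "k \<in> {1..n}"
  shows "(\<lambda>s. vol_poly n ((x \<circ> skip k)(k := a - s))) \<in> borel_measurable borel"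
  unfolding vol_poly_merge[OF k] by (intro borel_measurable_sum borel_measurable_times
    borel_measurable_const borel_measurable_divide borel_measurable_power borel_measurable_diff measurable_ident_sets) simp_all

text \<open>The substitution \<open>u = x k + x (Suc k) - s\<close> reflects the interval onto
  itself and swaps its ends. The second claim keeps \<open>ennreal\<close> from truncating the
  difference.\<close>

lemma nn_integral_vol_poly_merge:
  assumes k: "k \<in> {1..n}" and le: "x (Suc k) \<le> x k"
    and nonneg: "\<And>s. x (Suc k) \<le> s \<Longrightarrow> s \<le> x k \<Longrightarrow>
      vol_poly n ((x \<circ> skip k)(k := x k + x (Suc k) - s)) \<ge> 0"
  shows "(\<integral>\<^sup>+s. ennreal (vol_poly n ((x \<circ> skip k)(k := x k + x (Suc k) - s))) *
      indicator {x (Suc k)..x k} s \<partial>lborel) = ennreal (antideriv n k x (x k) - antideriv n k x (x (Suc k)))"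
    and "antideriv n k x (x (Suc k)) \<le> antideriv n k x (x k)"
proof -
  let ?f = "\<lambda>s. vol_poly n ((x \<circ> skip k)(k := x k + x (Suc k) - s))"
  let ?F = "\<lambda>s. - antideriv n k x (x k + x (Suc k) - s)"
  have deriv: "(?F has_real_derivative ?f s) (at s)" for s
  proof -
    have "((\<lambda>s. x k + x (Suc k) - s) has_real_derivative - 1) (at s)"
      by (auto intro!: derivative_eq_intros)
    from DERIV_minus[OF DERIV_chain2[OF has_real_derivative_antideriv[OF k] this]]
    show ?thesis
      by simp
  qed
  have "(\<integral>\<^sup>+s. ennreal (?f s) * indicator {x (Suc k)..x k} s \<partial>lborel) = ennreal (?F (x k) - ?F (x (Suc k)))"
    by (rule nn_integral_FTC_Icc) (use borel_measurable_vol_poly_merge[OF k] deriv nonneg le in auto)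
  then show "(\<integral>\<^sup>+s. ennreal (?f s) * indicator {x (Suc k)..x k} s \<partial>lborel) =
      ennreal (antideriv n k x (x k) - antideriv n k x (x (Suc k)))"
    by simp
  have "?F (x (Suc k)) \<le> ?F (x k)"
    by (rule DERIV_nonneg_imp_nondecreasing[OF le]) (use deriv nonneg in blast)
  then show "antideriv n k x (x (Suc k)) \<le> antideriv n k x (x k)"
    by simp
qed

text \<open>Nonnegativity is carried through the induction: \<open>ennreal\<close> hides negative
  values, and the integrals over slices rely on it.\<close>

lemma emeasure_proj:
  assumes "antimono_on {1..Suc n} x"
  shows "emeasure (\<Pi>\<^sub>M i\<in>{1..n}. lborel) (proj n x) = ennreal (vol_poly (Suc n) x) \<and> vol_poly (Suc n) x \<ge> 0"
  using assms
proof (induction n arbitrary: x)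
  case 0
  have "emeasure (\<Pi>\<^sub>M i\<in>{}. lborel :: real measure) {\<lambda>_. undefined} = 1"
    by (simp add: PiM_empty)
  then show ?case
    unfolding proj_0 vol_poly_1 by simp
next
  case (Suc n)
  note x = Suc.prems
  interpret product_sigma_finite "\<lambda>_ :: nat. lborel :: real measure"
    by standard
  let ?y = "\<lambda>k s. (x \<circ> skip k)(k := x k + x (Suc k) - s)"
  let ?h = "\<lambda>k s. ennreal (vol_poly (Suc n) (?y k s)) * indicator {x (Suc k)..x k} s"
  let ?M = "\<lambda>n. \<Pi>\<^sub>M i\<in>{1..n}. (lborel :: real measure)"
  define inner where "inner s = (\<integral>\<^sup>+u. indicator (proj (Suc n) x) (u(Suc n := s)) \<partial>?M n)" for s
  have ins: "{1..Suc n} = insert (Suc n) {1..n}"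
    by auto
  have le: "x b \<le> x a" if "1 \<le> a" "a \<le> b" "b \<le> Suc (Suc n)" for a b
    using that by (intro monotone_onD[OF x]) auto
  have IH: "emeasure (?M n) (proj n (?y k s)) = ennreal (vol_poly (Suc n) (?y k s))"
    "vol_poly (Suc n) (?y k s) \<ge> 0"
    if "k \<in> {1..Suc n}" "x (Suc k) \<le> s" "s \<le> x k" for k s
    using Suc.IH[OF antimono_merge[OF x that]] by blast+
  have inner_eq: "inner s = emeasure (?M n) (proj n (?y k s))"
    if k: "k \<in> {1..Suc n}" "x (Suc k) \<le> s" "s \<le> x k" for k s
  proof -
    have "inner s = (\<integral>\<^sup>+u. indicator (proj n (?y k s)) u \<partial>?M n)"
      unfolding inner_def
    proof (rule nn_integral_cong)
      fix u assume "u \<in> space (?M n)"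
      then have "u \<in> extensional {1..n}"
        by (auto simp: space_PiM PiE_def)
      from proj_slice_iff[OF x k this]
      show "indicator (proj (Suc n) x) (u(Suc n := s)) = (indicator (proj n (?y k s)) u :: ennreal)"
        by (simp only: indicator_def)
    qed
    then show ?thesis
      using nn_integral_indicator[OF proj_measurable] by simp
  qed
  have "emeasure (?M (Suc n)) (proj (Suc n) x) = (\<integral>\<^sup>+u. indicator (proj (Suc n) x) u \<partial>?M (Suc n))"
    by (rule nn_integral_indicator[symmetric]) (rule proj_measurable)
  \<comment> \<open>Tonelli: coordinate n + 1 is integrated last.\<close>
  also have "\<dots> = (\<integral>\<^sup>+s. inner s \<partial>lborel)"
  proof -
    have "indicator (proj (Suc n) x) \<in> borel_measurable (Pi\<^sub>M (insert (Suc n) {1..n}) (\<lambda>_. lborel))"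
      using proj_measurable[of "Suc n" x] unfolding ins by (rule borel_measurable_indicator)
    then show ?thesis
      unfolding inner_def ins by (intro product_nn_integral_insert_rev) auto
  qed
  also have "\<dots> = (\<integral>\<^sup>+s. (\<Sum>k=1..Suc n. ?h k s) \<partial>lborel)"
  proof (rule nn_integral_cong_AE)
    \<comment> \<open>Off the finitely many parameter values the intervals between consecutive
      parameters are disjoint, so at most one summand is nonzero.\<close>
    have "AE s in lborel. s \<notin> x ` {1..Suc (Suc n)}"
      by (intro AE_not_in finite_imp_null_set_lborel) auto
    then show "AE s in lborel. inner s = (\<Sum>k=1..Suc n. ?h k s)"
    proof eventually_elim
      case (elim s)
      have ne: "s \<noteq> x k" if "1 \<le> k" "k \<le> Suc (Suc n)" for k
        using elim that by auto
      show ?case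
      proof (cases "x (Suc (Suc n)) \<le> s \<and> s \<le> x 1")
        case True
        then obtain k where k: "k \<in> {1..Suc n}" "x (Suc k) \<le> s" "s \<le> x k"
          using rado_find_interval[of "Suc n" x s] by auto
        have "?h j s = (if j = k then inner s else 0)" if j: "j \<in> {1..Suc n}" for j
        proof (cases "j = k")
          case True
          then show ?thesis
            using inner_eq[OF k] IH(1)[OF k] k by simp
        next
          case False
          have "s \<notin> {x (Suc j)..x j}"
          proof (cases "j < k")
            case True
            then have "s < x (Suc j)"
              using le[of "Suc j" k] k j ne[of k] by force
            then show ?thesis by simp
          next
            case False
            then have "x j < s"
              using le[of "Suc k" j] k j ne[of "Suc k"] \<open>j \<noteq> k\<close> by force
            then show ?thesis by simp
          qed
          then show ?thesis
            using False by simp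
        qed
        then have "(\<Sum>j=1..Suc n. ?h j s) = (\<Sum>j=1..Suc n. if j = k then inner s else 0)"
          by (rule sum.cong[OF refl])
        also have "\<dots> = inner s"
          using k(1) by (simp only: sum.delta finite_atLeastAtMost if_True)
        finally show ?thesis ..
      next
        case False
        have "inner s = 0"
        proof -
          have "u(Suc n := s) \<notin> proj (Suc n) x" for u
            using proj_last_bounds[of u n s x] False by blast
          then show ?thesis
            unfolding inner_def by simp
        qed
        moreover have "?h k s = 0" if k: "k \<in> {1..Suc n}" for k
        proof -
          have "s \<notin> {x (Suc k)..x k}"
            using le[of 1 k] le[of "Suc k" "Suc (Suc n)"] k False by auto
          then show ?thesis by simp
        qed
        ultimately show ?thesis
          by (simp only: sum.neutral_const cong: sum.cong)
      qed
    qed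
  qed
  also have "\<dots> = (\<Sum>k=1..Suc n. \<integral>\<^sup>+s. ?h k s \<partial>lborel)"
  proof (rule nn_integral_sum)
    fix k assume "k \<in> {1..Suc n}"
    from borel_measurable_vol_poly_merge[OF this, of x "x k + x (Suc k)"]
    show "?h k \<in> borel_measurable lborel"
      by measurable
  qed
  also have "\<dots> = (\<Sum>k=1..Suc n. ennreal (antideriv (Suc n) k x (x k) - antideriv (Suc n) k x (x (Suc k))))"
    by (intro sum.cong[OF refl] nn_integral_vol_poly_merge(1)) (auto intro: le IH(2))
  also have "\<dots> = ennreal (\<Sum>k=1..Suc n. antideriv (Suc n) k x (x k) - antideriv (Suc n) k x (x (Suc k)))"
    (is "_ = ennreal ?S")
    using nn_integral_vol_poly_merge(2)[OF _ le IH(2)] by (intro sum_ennreal) auto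
  finally have "emeasure (?M (Suc n)) (proj (Suc n) x) = ennreal ?S" .
  moreover have "?S \<ge> 0"
    using nn_integral_vol_poly_merge(2)[OF _ le IH(2)] by (intro sum_nonneg) auto
  moreover have "vol_poly (Suc (Suc n)) x = ?S"
    by (rule vol_poly_rec) simp
  ultimately show ?case
    by (simp only:)
qed

theorem theorem3p2:
  fixes n :: nat and x :: "nat \<Rightarrow> real"
  assumes "n \<ge> 1"
    and "antimono_on {1..n} x"
  shows "Vol n (permutohedron n x) =
    (\<Sum>c\<in>exponents n. (-1) ^ card (I_set n c) * real (D n (I_set n c)) *
      (\<Prod>i=1..n. x i ^ c i / fact (c i)))"
proof -
  obtain m where m: "n = Suc m"
    using assms(1) by (cases n) auto
  have x: "antimono_on {1..Suc m} x"
    using assms(2) m by simp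
  have "Vol n (permutohedron n x) = measure (\<Pi>\<^sub>M i\<in>{1..m}. lborel) (proj m x)"
    unfolding Vol_def permutohedron_eq_rado[OF assms] restrict_rado[symmetric] by (simp add: m)
  \<comment> \<open>Since \<open>vol_poly\<close> is nonnegative, passing from
    \<open>ennreal\<close> back to reals loses nothing.\<close>
  also have "\<dots> = vol_poly n x"
    using emeasure_proj[OF x] m by (simp add: measure_def)
  finally show ?thesis
    by (simp add: vol_poly_def signed_D_def monomial_def)
qed

end
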